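(* Let $(X,\mathcal{B},\mu)$ be a probability space, $b\in(1,\infty]$, $\psi\in\Psi(b)$, and $\lambda>0$. (i) Let $Q$ be a (not necessarily linear) operator acting from $L_p(X,\mu)$ into $L_p(X,\mu)$ for every $p\in(1,\infty)$, and suppose there is a finite constant $Z=Z(Q)$ such that $$|Q[f]|_p\le Z(Q)\,\frac{p^{\lambda}}{(p-1)^{\lambda}}\,|f|_p,\qquad p\in[1,b)$$ (the right-hand side being read as $+\infty$ at $p=1$). Suppose $f\in G\psi$. Then the function $g=Q[f]$ belongs to the same Grand Lebesgue Space $G\psi$, or equivalently to the corresponding exponential Orlicz space $L(M_\psi)$, and $$\|g\|_{G\psi}\le K_\lambda[\psi,b]\;Z(Q)\;\|f\|_{G\psi},$$ or equally, in terms of exponential Orlicz spaces, $$\|g\|_{L(M_\psi)}\le C(\psi)\,K_\lambda[\psi,b]\;Z(Q)\;\|f\|_{L(M_\psi)},$$ where $C(\psi)$ is a finite constant depending on $\psi$. (ii) The same holds if, more generally, $g=Q(\vec f)=Q(f_1,f_2,\dots,f_N)$, $N\in\{1,2,\dots,\infty\}$, where $\vec f$ is a family of measurable functions such that for some finite constant $Z=Z(\vec f)$ $$|g|_p\le Z(\vec f)\,\frac{p^{\lambda}}{(p-1)^{\lambda}}\,\psi(p),\qquad p\in[1,b).$$ That is, $g$ belongs to $G\psi$, or equivalently to $L(M_\psi)$, and the estimates hold with the norm of the source function normalized to $1$: $$\|g\|_{G\psi}\le K_\lambda[\psi,b]\;Z(\vec f),\qquad \|g\|_{L(M_\psi)}\le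 C(\psi)\,K_\lambda[\psi,b]\;Z(\vec f).$$
   Context: $|f|_p=\left[\int_X|f|^p\,d\mu\right]^{1/p}$ is the usual $L_p(X,\mu)$ norm. For $b\in(1,\infty]$, $\Psi(b)$ is the set of functions $\psi$ that are finite and continuous on $[1,b)$, bounded from below by a positive constant and normalized (without loss of generality) by $\inf_{p\in[1,b)}\psi(p)=1$, with $b=\sup\{p:\psi(p)<\infty\}$. The Grand Lebesgue Space $G\psi$ consists of all real (or complex) valued measurable functions $f$ on $X$ with finite norm $\|f\|_{G\psi}=\sup_{p\in[1,b)}|f|_p/\psi(p)$. The constant $K_\lambda[\psi,b]$ is $$K_\lambda[\psi,b]=\inf_{q\in(1,b)}\frac{q^\lambda\,\psi(q)}{(q-1)^\lambda}.$$ The Young–Orlicz function $M_\psi$ is $M_\psi(y)=\exp\left(v_\psi^*(\ln|y|)\right)$ for $|y|\ge e$ and $M_\psi(y)=C y^2$ for $|y|<e$ ($C>0$ a constant), where $v_\psi(p)=p\ln\psi(p)$ and $v_\psi^*(u)=\sup_{p}(pu-v_\psi(p))$ is its Young–Fenchel transform, the supremum being over the $p\ge1$ with $\psi(p)<\infty$. $L(M_\psi)$ is the (exponential) Orlicz space over $(X,\mathcal{B},\mu)$ with Young–Orlicz function $M_\psi$.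
   Formalization: In (i), g∈L(M_ψ) is shown if f∈L(M_ψ) or Gψ=L(M_ψ); in (ii), g∈L(M_ψ) and its L(M_ψ) bound are shown if Gψ=L(M_ψ). This equality can fail (X=[0,1], ψ(p) proportional to |x^(-1/b)|_p, b finite). C(ψ) is chosen for the given X. *)

theory Defs
  imports "HOL-Probability.Probability"
begin

text \<open>
  Functions on \<open>X\<close> are real or complex valued: both are covered by the sort
  \<open>{real_normed_field, euclidean_space}\<close>, whose only models are, by the theorem of Frobenius,
  copies of the reals and of the complex numbers. Norms take values in \<open>ennreal\<close>, so that
  ``finite norm'' is the condition \<open>< \<top>\<close>. A function \<open>\<psi>\<close> has type \<open>real \<Rightarrow> ennreal\<close>; only its
  values on \<open>{1..}\<close> matter.
\<close>

definition Lp_norm ::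
  "'a measure \<Rightarrow> real \<Rightarrow> ('a \<Rightarrow> 'k::{real_normed_field,euclidean_space}) \<Rightarrow> ennreal" where
  "Lp_norm M p f =
     (let I = (\<integral>\<^sup>+x. ennreal (norm (f x) powr p) \<partial>M)
      in if I = \<top> then \<top> else ennreal (enn2real I powr (1 / p)))"

definition Lp_space ::
  "'a measure \<Rightarrow> real \<Rightarrow> ('a \<Rightarrow> 'k::{real_normed_field,euclidean_space}) set" where
  "Lp_space M p = {f \<in> borel_measurable M. Lp_norm M p f < \<top>}"

definition Psi :: "ereal \<Rightarrow> (real \<Rightarrow> ennreal) set" where
  "Psi b = {\<psi>.
     (\<forall>p. 1 \<le> p \<and> ereal p < b \<longrightarrow> \<psi> p < \<top>) \<and>
     continuous_on {p. 1 \<le> p \<and> ereal p < b} \<psi> \<and>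
     (\<exists>c>0. \<forall>p\<ge>1. c \<le> \<psi> p) \<and>
     (INF p\<in>{p. 1 \<le> p \<and> ereal p < b}. \<psi> p) = 1 \<and>
     b = (SUP p\<in>{p. 1 \<le> p \<and> \<psi> p < \<top>}. ereal p)}"

definition GLS_norm ::
  "'a measure \<Rightarrow> ereal \<Rightarrow> (real \<Rightarrow> ennreal) \<Rightarrow>
   ('a \<Rightarrow> 'k::{real_normed_field,euclidean_space}) \<Rightarrow> ennreal" where
  "GLS_norm M b \<psi> f = (SUP p\<in>{p. 1 \<le> p \<and> ereal p < b}. Lp_norm M p f / \<psi> p)"

definition GLS ::
  "'a measure \<Rightarrow> ereal \<Rightarrow> (real \<Rightarrow> ennreal) \<Rightarrow>
   ('a \<Rightarrow> 'k::{real_normed_field,euclidean_space}) set" where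
  "GLS M b \<psi> = {f \<in> borel_measurable M. GLS_norm M b \<psi> f < \<top>}"

definition K_const :: "real \<Rightarrow> (real \<Rightarrow> ennreal) \<Rightarrow> ereal \<Rightarrow> ennreal" where
  "K_const l \<psi> b =
     (INF q\<in>{q. 1 < q \<and> ereal q < b}. ennreal (q powr l) * \<psi> q / ennreal ((q - 1) powr l))"

definition v_fun :: "(real \<Rightarrow> ennreal) \<Rightarrow> real \<Rightarrow> real" where
  "v_fun \<psi> p = p * ln (enn2real (\<psi> p))"

definition v_conj :: "(real \<Rightarrow> ennreal) \<Rightarrow> real \<Rightarrow> ereal" where
  "v_conj \<psi> u = (SUP p\<in>{p. 1 \<le> p \<and> \<psi> p < \<top>}. ereal (p * u - v_fun \<psi> p))"

definition exp_ext :: "ereal \<Rightarrow> ennreal" where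
  "exp_ext x = (case x of ereal r \<Rightarrow> ennreal (exp r) | PInfty \<Rightarrow> \<top> | MInfty \<Rightarrow> 0)"

text \<open>
  The value \<open>\<top>\<close> does occur: if \<open>\<psi>\<close> is bounded and \<open>b = \<infinity>\<close>, then \<open>v_conj \<psi> u = \<infinity>\<close> for large \<open>u\<close>.
  The constant \<open>C\<close> is arbitrary, so the function need not be monotone, continuous or convex
  at \<open>\<bar>y\<bar> = exp 1\<close>.
\<close>

definition M_fun :: "real \<Rightarrow> (real \<Rightarrow> ennreal) \<Rightarrow> real \<Rightarrow> ennreal" where
  "M_fun C \<psi> y =
     (if exp 1 \<le> \<bar>y\<bar> then exp_ext (v_conj \<psi> (ln \<bar>y\<bar>)) else ennreal (C * y\<^sup>2))"

text \<open>The Luxemburg norm; it is \<open>\<top>\<close> if no admissible \<open>k\<close> exists.\<close>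

definition Orlicz_norm ::
  "'a measure \<Rightarrow> (real \<Rightarrow> ennreal) \<Rightarrow> ('a \<Rightarrow> 'k::{real_normed_field,euclidean_space}) \<Rightarrow> ennreal" where
  "Orlicz_norm M \<Phi> f =
     (INF k\<in>{k::real. 0 < k \<and> (\<integral>\<^sup>+x. \<Phi> (norm (f x) / k) \<partial>M) \<le> 1}. ennreal k)"

definition Orlicz_space ::
  "'a measure \<Rightarrow> (real \<Rightarrow> ennreal) \<Rightarrow> ('a \<Rightarrow> 'k::{real_normed_field,euclidean_space}) set" where
  "Orlicz_space M \<Phi> = {f \<in> borel_measurable M. Orlicz_norm M \<Phi> f < \<top>}"

text \<open>
  \<open>Orlicz_space M (M_fun C \<psi>)\<close> is always contained in \<open>GLS M b \<psi>\<close>, but the two can differ: on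
  \<open>[0,1]\<close>, with finite \<open>b\<close> and \<open>\<psi>\<close> proportional to the \<open>L\<^sub>p\<close> norm of \<open>f x = x powr (- 1 / b)\<close>, the
  function \<open>f\<close> lies only in the latter. Hence the passage from one space to the other needs their
  equality as a premise.
\<close>

end

theory Submission
  imports Defs
begin

text \<open>
  For the \<open>G\<psi>\<close> norm, fix \<open>q \<in> (1,b)\<close>. For \<open>p \<ge> q\<close> the factor \<open>(p/(p-1))\<^sup>\<lambda>\<close> is at most its value at
  \<open>q\<close>, and for \<open>p < q\<close> Lyapunov's inequality replaces the \<open>L\<^sub>p\<close> norm of \<open>g\<close> by the \<open>L\<^sub>q\<close> norm;
  \<open>\<psi> \<ge> 1\<close> does the rest.

  For the Orlicz norm the two spaces need not coincide, so an operator bound for the single \<open>L\<^sub>p\<close> norms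
  has to be transferred to the integral of \<open>exp (v\<^sup>* (ln \<bar>g\<bar>)) = sup\<^sub>p (\<bar>g\<bar> / \<psi>(p))\<^sup>p\<close>. The supremum
  of finitely many functions \<open>exp (p u - v(p))\<close> is comparable, with absolute constants, to the sum over a
  suitable sparse subfamily (lemma \<open>sparse_envelope\<close>), and a sum can be integrated term by term, each
  term being a moment of \<open>g\<close> controlled by the same moment of \<open>f\<close>. Exhausting the family of all \<open>p\<close>
  by finite ones gives a constant that depends on \<open>\<psi>\<close> and \<open>C\<close> only.

  In part (ii) the equality of the spaces is turned into a norm inequality by a gliding hump.
\<close>

section \<open>Sparse subfamilies of envelopes\<close>

text \<open>Only every second element is known to lose 1, so the two smallest are peeled off
  together. They contribute at most \<open>2 * exp m\<close>, and the rest satisfies the hypotheses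
  with \<open>m - 1\<close>; since \<open>exp 1\<close> is at least 2,
  \<open>4 * exp (m - 1)\<close> fits into the remaining \<open>2 * exp m\<close>.\<close>

lemma geometric_sum_bound:
  fixes a :: "real \<Rightarrow> real"
  assumes "finite A" and "\<And>p. p \<in> A \<Longrightarrow> a p \<le> m"
    and "\<And>p r s. p \<in> A \<Longrightarrow> r \<in> A \<Longrightarrow> s \<in> A \<Longrightarrow> p < r \<Longrightarrow> r < s \<Longrightarrow> a s \<le> a p - 1"
  shows "(\<Sum>p\<in>A. exp (a p)) \<le> 4 * exp m"
  using assms
proof (induction "card A" arbitrary: A m rule: less_induct)
  case less
  show ?case
  proof (cases "A = {}")
    case False
    define x where "x = Min A"
    define A1 where "A1 = A - {x}"
    have x: "x \<in> A" "\<And>y. y \<in> A1 \<Longrightarrow> x < y"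
      using less.prems(1) False Min_le[of A] by (auto simp: x_def A1_def order.strict_iff_order)
    have split: "(\<Sum>p\<in>A. exp (a p)) = exp (a x) + (\<Sum>p\<in>A1. exp (a p))"
      unfolding A1_def using x(1) less.prems(1) by (simp add: sum.remove)
    have ax: "exp (a x) \<le> exp m" using less.prems(2) x by simp
    show ?thesis
    proof (cases "A1 = {}")
      case True
      then have "(\<Sum>p\<in>A. exp (a p)) = exp (a x)" using split by simp
      then show ?thesis using ax exp_gt_zero[of m] by linarith
    next
      case False
      define y where "y = Min A1"
      define A2 where "A2 = A1 - {y}"
      have fin1: "finite A1" using less.prems(1) by (simp add: A1_def)
      have y: "y \<in> A1" "\<And>z. z \<in> A2 \<Longrightarrow> y < z"
        using fin1 False Min_le[of A1] by (auto simp: y_def A2_def order.strict_iff_order)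
      have split2: "(\<Sum>p\<in>A1. exp (a p)) = exp (a y) + (\<Sum>p\<in>A2. exp (a p))"
        unfolding A2_def using y(1) fin1 by (simp add: sum.remove)
      have ay: "exp (a y) \<le> exp m" using less.prems(2) y by (simp add: A1_def)
      have sub: "A2 \<subset> A" "A2 \<subseteq> A" using x y by (auto simp: A1_def A2_def)
      have "(\<Sum>p\<in>A2. exp (a p)) \<le> 4 * exp (m - 1)"
      proof (rule less.hyps)
        show "card A2 < card A" using sub less.prems(1) by (simp add: psubset_card_mono)
        show "finite A2" using sub less.prems(1) finite_subset by blast
        show "a p \<le> m - 1" if "p \<in> A2" for p
        proof -
          have "a p \<le> a x - 1"
            using less.prems(3)[of x y p] x y that by (auto simp: A1_def A2_def)
          then show ?thesis using less.prems(2)[OF x(1)] by simp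
        qed
        show "a s \<le> a p - 1" if "p \<in> A2" "r \<in> A2" "s \<in> A2" "p < r" "r < s" for p r s
          using less.prems(3) sub that by blast
      qed
      moreover have "4 * exp (m - 1) \<le> 2 * exp m"
        using exp_ge_add_one_self[of "1::real"] by (simp add: exp_diff divide_simps)
      ultimately show ?thesis using split split2 ax ay by linarith
    qed
  qed simp
qed

text \<open>Reflection \<open>p \<mapsto> - p\<close> of the previous bound; it serves the lines
  that touch the envelope to the left of the point considered.\<close>

lemma geometric_sum_bound_dual:
  fixes a :: "real \<Rightarrow> real"
  assumes "finite A" and "\<And>p. p \<in> A \<Longrightarrow> a p \<le> m"
    and "\<And>p r s. p \<in> A \<Longrightarrow> r \<in> A \<Longrightarrow> s \<in> A \<Longrightarrow> p < r \<Longrightarrow> r < s \<Longrightarrow> a p \<le> a s - 1"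
  shows "(\<Sum>p\<in>A. exp (a p)) \<le> 4 * exp m"
proof -
  have "(\<Sum>p\<in>uminus ` A. exp (a (- p))) \<le> 4 * exp m"
    using assms by (intro geometric_sum_bound) auto
  then show ?thesis by (simp add: sum.reindex)
qed

text \<open>The lower line is the steeper one, so its deficit only grows towards the left. The next
  lemma is the mirror image.\<close>

lemma line_gap_left:
  fixes p q :: real
  assumes "p * t - c \<le> q * t - d - \<delta>" and "q \<le> p" and "u \<le> t"
  shows "p * u - c \<le> q * u - d - \<delta>"
proof -
  have "0 \<le> (p - q) * (t - u)" using assms by simp
  then show ?thesis using assms(1) by (simp add: algebra_simps)
qed

lemma line_gap_right:
  fixes p q :: real
  assumes "p * t - c \<le> q * t - d - \<delta>" and "p \<le> q" and "t \<le> u"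
  shows "p * u - c \<le> q * u - d - \<delta>"
proof -
  have "0 \<le> (q - p) * (u - t)" using assms by simp
  then show ?thesis using assms(1) by (simp add: algebra_simps)
qed

text \<open>
  Take a minimal subfamily \<open>T\<close> of lines that touch the envelope such that \<open>T\<close> stays within \<open>1\<close> of
  it. By minimality every line of \<open>T\<close> has a private point \<open>x\<close>, and it has a touching point \<open>t\<close>;
  together they force every second line of \<open>T\<close> to lose at least \<open>1\<close>, so that the sums are geometric.
\<close>

lemma sparse_envelope:
  fixes S :: "real set" and c :: "real \<Rightarrow> real"
  assumes "finite S" and "S \<noteq> {}"
  shows "\<exists>T\<subseteq>S. (\<forall>u. \<exists>p\<in>T. \<forall>q\<in>S. q * u - c q \<le> p * u - c p + 1) \<and>
    (\<forall>u. \<exists>q\<in>S. (\<Sum>p\<in>T. exp (p * u - c p)) \<le> 8 * exp (q * u - c q))"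
proof -
  define l where "l p u = p * u - c p" for p u
  have top: "\<exists>p\<in>S. \<forall>q\<in>S. l q u \<le> l p u" for u
  proof -
    have "Max ((\<lambda>p. l p u) ` S) \<in> (\<lambda>p. l p u) ` S" using assms by simp
    then obtain p where "p \<in> S" "Max ((\<lambda>p. l p u) ` S) = l p u" by auto
    then show ?thesis using assms by (metis (mono_tags, lifting) Max_ge finite_imageI imageI)
  qed
  define E where "E = {p\<in>S. \<exists>t. \<forall>q\<in>S. l q t \<le> l p t}"
  define cov where "cov T \<longleftrightarrow> (\<forall>u. \<exists>p\<in>T. \<forall>q\<in>S. l q u \<le> l p u + 1)" for T
  define \<C> where "\<C> = {T. T \<subseteq> E \<and> cov T}"
  have "cov E" unfolding cov_def E_def
  proof
    fix u
    obtain p where "p \<in> S" "\<forall>q\<in>S. l q u \<le> l p u" using top by blast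
    then show "\<exists>p\<in>{p \<in> S. \<exists>t. \<forall>q\<in>S. l q t \<le> l p t}. \<forall>q\<in>S. l q u \<le> l p u + 1"
      by (intro bexI[of _ p]) force+
  qed
  moreover have "finite E" using assms by (simp add: E_def)
  ultimately have "finite \<C>" "\<C> \<noteq> {}" by (auto simp: \<C>_def)
  then obtain T where T: "T \<in> \<C>" and min: "\<And>T'. T' \<in> \<C> \<Longrightarrow> T' \<subseteq> T \<Longrightarrow> T' = T"
    using finite_has_minimal[of \<C>] by metis
  have TE: "T \<subseteq> E" and covT: "cov T" using T by (auto simp: \<C>_def)
  have finT: "finite T" and TS: "T \<subseteq> S"
    using TE \<open>finite E\<close> finite_subset by (auto simp: E_def)
  \<comment> \<open>Minimality: removing \<open>p\<close> destroys the covering, and a point where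
    this shows is covered by \<open>p\<close> alone.\<close>
  have "\<exists>x. (\<forall>q\<in>S. l q x \<le> l p x + 1) \<and> (\<forall>r\<in>T - {p}. \<exists>q\<in>S. l q x > l r x + 1)" if "p \<in> T" for p
  proof -
    have "\<not> cov (T - {p})" using min[of "T - {p}"] that TE by (auto simp: \<C>_def)
    then obtain x where x: "\<forall>r\<in>T - {p}. \<exists>q\<in>S. l q x > l r x + 1"
      by (auto simp: cov_def not_le)
    moreover obtain r where "r \<in> T" "\<forall>q\<in>S. l q x \<le> l r x + 1" using covT by (auto simp: cov_def)
    ultimately have "r = p" by force
    then show ?thesis using x \<open>\<forall>q\<in>S. l q x \<le> l r x + 1\<close> by blast
  qed
  then obtain x where x1: "\<And>p q. p \<in> T \<Longrightarrow> q \<in> S \<Longrightarrow> l q (x p) \<le> l p (x p) + 1"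
    and x2: "\<And>p r. p \<in> T \<Longrightarrow> r \<in> T \<Longrightarrow> r \<noteq> p \<Longrightarrow> \<exists>q\<in>S. l q (x p) > l r (x p) + 1"
    by (metis Diff_iff singletonD)
  have "\<forall>p\<in>T. \<exists>t. \<forall>q\<in>S. l q t \<le> l p t" using TE by (auto simp: E_def)
  then obtain t where t: "\<And>p q. p \<in> T \<Longrightarrow> q \<in> S \<Longrightarrow> l q (t p) \<le> l p (t p)" by metis
  have x_gap: "l r (x p) < l p (x p)" if "p \<in> T" "r \<in> T" "r \<noteq> p" for p r
    using x1[OF that(1)] x2[OF that] by force
  \<comment> \<open>A line of larger slope overtakes another only further to the right. Hence the
    private points are ordered like the slopes.\<close>
  have lt_iff: "a < b" if "l s a < l r a" "l r b < l s b" "r < s" for a b r s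
  proof (rule ccontr)
    assume "\<not> a < b"
    then have "0 \<le> (s - r) * (a - b)" using that by simp
    then show False using that by (simp add: l_def algebra_simps)
  qed
  \<comment> \<open>The envelope line \<open>q\<close> through the private point of \<open>r\<close> separates \<open>p\<close> from \<open>s\<close>.\<close>
  have gap: "(u \<le> t p \<longrightarrow> l s u \<le> l p u - 1) \<and> (t s \<le> u \<longrightarrow> l p u \<le> l s u - 1)"
    if T3: "p \<in> T" "r \<in> T" "s \<in> T" and ord: "p < r" "r < s" for p r s u
  proof -
    have xx: "x p < x r" "x r < x s"
      using lt_iff x_gap T3 ord by (metis less_irrefl)+
    obtain q where q: "q \<in> S" "\<forall>q'\<in>S. l q' (x r) \<le> l q (x r)" using top by blast
    have qp: "l p (x r) < l q (x r) - 1" and qs: "l s (x r) < l q (x r) - 1"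
      using x2[of r p] x2[of r s] T3 ord q by force+
    \<comment> \<open>The excess of \<open>q\<close> over \<open>s\<close> is more than 1 at
      \<open>x r\<close> but at most 1 at \<open>x s\<close>, further right, so \<open>s\<close> is
      steeper. The argument for \<open>p < q\<close> is symmetric, with \<open>x p\<close> on the
      left.\<close>
    have "q < s"
    proof (rule ccontr)
      assume "\<not> q < s"
      then have "0 \<le> (q - s) * (x s - x r)" using xx by simp
      then show False using qs x1[OF T3(3) q(1)] by (simp add: l_def algebra_simps)
    qed
    have "p < q"
    proof (rule ccontr)
      assume "\<not> p < q"
      then have "0 \<le> (p - q) * (x r - x p)" using xx by simp
      then show False using qp x1[OF T3(1) q(1)] by (simp add: l_def algebra_simps)
    qed
    \<comment> \<open>To the right of \<open>x r\<close> the steeper line \<open>q\<close> stays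
      strictly above \<open>p\<close>, which therefore cannot touch the envelope there.\<close>
    have tp: "t p \<le> x r"
    proof (rule ccontr)
      assume "\<not> t p \<le> x r"
      then have "0 \<le> (q - p) * (t p - x r)" using \<open>p < q\<close> by simp
      then show False using qp t[OF T3(1) q(1)] by (simp add: l_def algebra_simps)
    qed
    have ts: "x r \<le> t s"
    proof (rule ccontr)
      assume "\<not> x r \<le> t s"
      then have "0 \<le> (s - q) * (x r - t s)" using \<open>q < s\<close> by simp
      then show False using qs t[OF T3(3) q(1)] by (simp add: l_def algebra_simps)
    qed
    show ?thesis
    proof (intro conjI impI)
      assume u: "u \<le> t p"
      have "l s u \<le> l q u - 1"
        using line_gap_left[of s "x r" "c s" q "c q" 1 u] qs \<open>q < s\<close> u tp by (simp add: l_def)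
      also have "l q u \<le> l p u"
        using line_gap_left[of q "t p" "c q" p "c p" 0 u] t[OF T3(1) q(1)] \<open>p < q\<close> u by (simp add: l_def)
      finally show "l s u \<le> l p u - 1" by simp
    next
      assume u: "t s \<le> u"
      have "l p u \<le> l q u - 1"
        using line_gap_right[of p "x r" "c p" q "c q" 1 u] qp \<open>p < q\<close> u ts by (simp add: l_def)
      also have "l q u \<le> l s u"
        using line_gap_right[of q "t s" "c q" s "c s" 0 u] t[OF T3(3) q(1)] \<open>q < s\<close> u by (simp add: l_def)
      finally show "l p u \<le> l s u - 1" by simp
    qed
  qed
  show ?thesis
  proof (intro exI conjI allI)
    show "T \<subseteq> S" by fact
    show "\<exists>p\<in>T. \<forall>q\<in>S. q * u - c q \<le> p * u - c p + 1" for u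
      using covT by (simp add: cov_def l_def)
    show "\<exists>q\<in>S. (\<Sum>p\<in>T. exp (p * u - c p)) \<le> 8 * exp (q * u - c q)" for u
    proof -
      obtain q where q: "q \<in> S" "\<forall>q'\<in>S. l q' u \<le> l q u" using top by blast
      \<comment> \<open>Touching points split the sum: on \<open>R\<close> the exponents at
        \<open>u\<close> decay as the slope grows, on \<open>L\<close> as it falls. Each half is
        geometric with bound 4, whence the 8.\<close>
      define L where "L = {p\<in>T. t p < u}"
      define R where "R = {p\<in>T. u \<le> t p}"
      have "(\<Sum>p\<in>L. exp (l p u)) \<le> 4 * exp (l q u)"
        using finT gap q TS by (intro geometric_sum_bound_dual) (auto simp: L_def less_imp_le)
      moreover have "(\<Sum>p\<in>R. exp (l p u)) \<le> 4 * exp (l q u)"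
        using finT gap q TS by (intro geometric_sum_bound) (auto simp: R_def)
      moreover have "(\<Sum>p\<in>T. exp (l p u)) = (\<Sum>p\<in>L. exp (l p u)) + (\<Sum>p\<in>R. exp (l p u))"
        using finT by (subst sum.union_disjoint[symmetric]) (auto simp: L_def R_def intro!: sum.cong)
      ultimately show ?thesis using q(1) by (intro bexI[of _ q]) (auto simp: l_def)
    qed
  qed
qed

section \<open>The Young--Orlicz function as a supremum\<close>

abbreviation dom_of :: "(real \<Rightarrow> ennreal) \<Rightarrow> real set" where
  "dom_of \<psi> \<equiv> {p. 1 \<le> p \<and> \<psi> p < \<top>}"

lemma exp_ext_ereal [simp]: "exp_ext (ereal r) = ennreal (exp r)"
  by (simp add: exp_ext_def)

lemma exp_ext_mono: "x \<le> y \<Longrightarrow> exp_ext x \<le> exp_ext y"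
  by (cases x; cases y) (auto simp: exp_ext_def intro!: ennreal_leI)

text \<open>A finite supremum of exponentials is positive because \<open>I\<close> is nonempty, so
  its logarithm bounds all exponents. This turns the large branch of \<open>M_fun\<close> into a
  supremum of powers.\<close>

lemma exp_ext_SUP:
  fixes f :: "'i \<Rightarrow> real"
  assumes "I \<noteq> {}"
  shows "exp_ext (SUP i\<in>I. ereal (f i)) = (SUP i\<in>I. ennreal (exp (f i)))"
proof (rule antisym)
  show "(SUP i\<in>I. ennreal (exp (f i))) \<le> exp_ext (SUP i\<in>I. ereal (f i))"
  proof (rule SUP_least)
    fix i assume "i \<in> I"
    then have "exp_ext (ereal (f i)) \<le> exp_ext (SUP i\<in>I. ereal (f i))"
      by (intro exp_ext_mono SUP_upper)
    then show "ennreal (exp (f i)) \<le> exp_ext (SUP i\<in>I. ereal (f i))" by simp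
  qed
  show "exp_ext (SUP i\<in>I. ereal (f i)) \<le> (SUP i\<in>I. ennreal (exp (f i)))" (is "_ \<le> ?s")
  proof (cases ?s)
    case (real r)
    have le: "exp (f i) \<le> r" if "i \<in> I" for i
      using SUP_upper[of i I "\<lambda>i. ennreal (exp (f i))"] that real by simp
    obtain i where "i \<in> I" using assms by auto
    then have "0 < r" using le by (meson exp_gt_zero less_le_trans)
    have "(SUP i\<in>I. ereal (f i)) \<le> ereal (ln r)"
      using le \<open>0 < r\<close> by (intro SUP_least) (simp add: ln_ge_iff)
    then have "exp_ext (SUP i\<in>I. ereal (f i)) \<le> exp_ext (ereal (ln r))"
      by (rule exp_ext_mono)
    then show ?thesis using real \<open>0 < r\<close> by simp
  next
    case top
    then show ?thesis by (simp only: top_greatest)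
  qed
qed

text \<open>The bound \<open>1 \<le> \<psi> p\<close> holds below \<open>b\<close>. At
  \<open>p = b\<close> the value may still be finite, with only positivity known;
  \<open>moment_le_endpoint\<close> and \<open>v_fun_bounded\<close> take care of this
  endpoint.\<close>

lemma PsiD:
  assumes "\<psi> \<in> Psi b" and "1 < b"
  shows Psi_finite: "\<And>p. 1 \<le> p \<Longrightarrow> ereal p < b \<Longrightarrow> \<psi> p < \<top>"
    and Psi_ge_1: "\<And>p. 1 \<le> p \<Longrightarrow> ereal p < b \<Longrightarrow> 1 \<le> \<psi> p"
    and Psi_pos: "\<And>p. 1 \<le> p \<Longrightarrow> 0 < \<psi> p"
    and Psi_dom_le: "\<And>p. 1 \<le> p \<Longrightarrow> \<psi> p < \<top> \<Longrightarrow> ereal p \<le> b"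
proof -
  have fin: "\<forall>p. 1 \<le> p \<and> ereal p < b \<longrightarrow> \<psi> p < \<top>"
    and pos: "\<exists>c>0. \<forall>p\<ge>1. c \<le> \<psi> p"
    and inf: "(INF p\<in>{p. 1 \<le> p \<and> ereal p < b}. \<psi> p) = 1"
    and sup: "b = (SUP p\<in>dom_of \<psi>. ereal p)"
    using assms(1) unfolding Psi_def by blast+
  show "\<psi> p < \<top>" if "1 \<le> p" "ereal p < b" for p
    using fin that by blast
  show "1 \<le> \<psi> p" if "1 \<le> p" "ereal p < b" for p
    unfolding inf[symmetric] using that by (intro INF_lower) simp
  obtain c where "c > 0" "\<forall>p\<ge>1. c \<le> \<psi> p" using pos by blast
  then show "0 < \<psi> p" if "1 \<le> p" for p
    using that by (metis less_le_trans)
  show "ereal p \<le> b" if "1 \<le> p" "\<psi> p < \<top>" for p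
    by (subst sup, intro SUP_upper) (use that in simp)
qed

lemma Psi_enn2real_ge_1:
  assumes "\<psi> \<in> Psi b" and "1 < b" and "1 \<le> p" and "ereal p < b"
  shows "1 \<le> enn2real (\<psi> p)" and "ennreal (enn2real (\<psi> p)) = \<psi> p"
proof -
  show eq: "ennreal (enn2real (\<psi> p)) = \<psi> p"
    using Psi_finite[OF assms] by simp
  then show "1 \<le> enn2real (\<psi> p)"
    using enn2real_mono[OF Psi_ge_1[OF assms] Psi_finite[OF assms]] by simp
qed

lemma exp_line_eq:
  assumes "0 < y" and "0 < enn2real (\<psi> p)"
  shows "exp (p * ln y - v_fun \<psi> p) = (y / enn2real (\<psi> p)) powr p"
  using assms by (simp add: powr_def v_fun_def ln_div algebra_simps)

lemma M_fun_large:
  assumes "exp 1 \<le> y" and "dom_of \<psi> \<noteq> {}"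
  shows "M_fun C \<psi> y = (SUP p\<in>dom_of \<psi>. ennreal (exp (p * ln y - v_fun \<psi> p)))"
proof -
  have "0 < y" using assms(1) by (meson exp_gt_zero less_le_trans)
  then show ?thesis using assms by (simp add: M_fun_def v_conj_def exp_ext_SUP)
qed

text \<open>Since \<open>v\<close> is arbitrary, a countable dense subset is taken in its graph
  rather than in \<open>D\<close>; for fixed \<open>u\<close> the exponential is continuous in slope
  and intercept. A sequence of lines makes monotone convergence over finite subfamilies
  available.\<close>

lemma SUP_lines_countable:
  fixes D :: "real set" and v :: "real \<Rightarrow> real"
  assumes "D \<noteq> {}"
  shows "\<exists>r :: nat \<Rightarrow> real. range r \<subseteq> D \<and>
    (\<forall>u. (SUP p\<in>D. ennreal (exp (p * u - v p))) \<le> (SUP n. ennreal (exp (r n * u - v (r n)))))"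
proof -
  define S where "S = (\<lambda>p. (p, v p)) ` D"
  obtain T where T: "countable T" "T \<subseteq> S" "S \<subseteq> closure T" using separable by blast
  have "T \<noteq> {}" using T assms by (auto simp: S_def)
  define r where "r n = fst (from_nat_into T n)" for n
  have r: "from_nat_into T n = (r n, v (r n))" "r n \<in> D" for n
    using from_nat_into[OF \<open>T \<noteq> {}\<close>, of n] T(2) by (auto simp: r_def S_def)
  show ?thesis
  proof (intro exI conjI allI)
    show "range r \<subseteq> D" using r by auto
    fix u :: real
    define s where "s = (SUP n. ennreal (exp (r n * u - v (r n))))"
    have "closure T \<subseteq> {z. ennreal (exp (fst z * u - snd z)) \<le> s}"
    proof (rule closure_minimal)
      show "T \<subseteq> {z. ennreal (exp (fst z * u - snd z)) \<le> s}"
      proof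
        fix z assume "z \<in> T"
        then obtain n where "z = from_nat_into T n"
          using from_nat_into_surj[OF T(1)] by metis
        then show "z \<in> {z. ennreal (exp (fst z * u - snd z)) \<le> s}"
          by (auto simp: r s_def intro!: SUP_upper2[of n])
      qed
      show "closed {z. ennreal (exp (fst z * u - snd z)) \<le> s}"
        by (intro closed_Collect_le continuous_intros continuous_on_ennreal)
    qed
    then show "(SUP p\<in>D. ennreal (exp (p * u - v p))) \<le> (SUP n. ennreal (exp (r n * u - v (r n))))"
      using T(3) unfolding s_def[symmetric] by (intro SUP_least) (force simp: S_def)
  qed
qed

section \<open>Transfer of moment bounds to the Orlicz integral\<close>

lemma powr_le_1_plus_powr:
  fixes x :: real
  assumes "0 \<le> x" and "0 \<le> p" and "p \<le> q"
  shows "x powr p \<le> 1 + x powr q"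
proof (cases "x \<le> 1")
  case True
  then have "x powr p \<le> 1 powr p" using assms by (intro powr_mono2) auto
  then show ?thesis by (simp add: add_increasing2)
next
  case False
  then have "x powr p \<le> x powr q" using assms by (intro powr_mono) auto
  then show ?thesis by simp
qed

text \<open>Exponents \<open>p n\<close> below \<open>c\<close> tend to \<open>c\<close>. Fatou's
  lemma handles the left side, and \<open>powr_le_1_plus_powr\<close> bounds the right side at the
  cost of the summand 1.\<close>

lemma (in prob_space) moment_le_endpoint:
  fixes F G :: "'a \<Rightarrow> real"
  assumes [measurable]: "F \<in> borel_measurable M" "G \<in> borel_measurable M"
    and nonneg: "\<And>x. 0 \<le> F x" "\<And>x. 0 \<le> G x" and "0 < q" and "q < c"
    and le: "\<And>p. q \<le> p \<Longrightarrow> p < c \<Longrightarrow>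
      (\<integral>\<^sup>+x. ennreal (G x powr p) \<partial>M) \<le> (\<integral>\<^sup>+x. ennreal (F x powr p) \<partial>M)"
  shows "(\<integral>\<^sup>+x. ennreal (G x powr c) \<partial>M) \<le> 1 + (\<integral>\<^sup>+x. ennreal (F x powr c) \<partial>M)"
proof -
  define p where "p n = c - (c - q) / real (Suc n)" for n
  have p: "q \<le> p n" "p n < c" for n
    using assms(5,6) by (auto simp: p_def field_simps intro: mult_right_mono)
  have "p \<longlonglongrightarrow> c - 0"
    unfolding p_def by (intro tendsto_intros LIMSEQ_Suc[OF lim_const_over_n])
  then have plim: "p \<longlonglongrightarrow> c" by simp
  have lim: "(\<lambda>n. ennreal (G x powr p n)) \<longlonglongrightarrow> ennreal (G x powr c)" for x
  proof (cases "G x = 0")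
    case False
    then show ?thesis by (intro tendsto_ennrealI tendsto_powr tendsto_const plim) simp
  qed simp
  have "(\<integral>\<^sup>+x. ennreal (G x powr c) \<partial>M) = (\<integral>\<^sup>+x. liminf (\<lambda>n. ennreal (G x powr p n)) \<partial>M)"
    using lim_imp_Liminf[OF _ lim] by simp
  also have "\<dots> \<le> liminf (\<lambda>n. \<integral>\<^sup>+x. ennreal (G x powr p n) \<partial>M)"
    by (intro nn_integral_liminf) measurable
  also have "\<dots> \<le> 1 + (\<integral>\<^sup>+x. ennreal (F x powr c) \<partial>M)"
  proof (rule Liminf_le)
    show "\<forall>\<^sub>F n in sequentially. (\<integral>\<^sup>+x. ennreal (G x powr p n) \<partial>M) \<le> 1 + (\<integral>\<^sup>+x. ennreal (F x powr c) \<partial>M)"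
    proof (rule always_eventually, rule allI)
      fix n
      have "(\<integral>\<^sup>+x. ennreal (G x powr p n) \<partial>M) \<le> (\<integral>\<^sup>+x. ennreal (F x powr p n) \<partial>M)"
        using le p by simp
      also have "\<dots> \<le> (\<integral>\<^sup>+x. 1 + ennreal (F x powr c) \<partial>M)"
      proof (rule nn_integral_mono)
        fix x
        have "F x powr p n \<le> 1 + F x powr c"
          using powr_le_1_plus_powr[OF nonneg(1), of "p n" c] p[of n] \<open>0 < q\<close> by simp
        then show "ennreal (F x powr p n) \<le> 1 + ennreal (F x powr c)"
          by (metis ennreal_1 ennreal_leI ennreal_plus powr_ge_zero zero_le_one)
      qed
      also have "\<dots> = 1 + (\<integral>\<^sup>+x. ennreal (F x powr c) \<partial>M)"
        by (subst nn_integral_add) (auto simp: emeasure_space_1)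
      finally show "(\<integral>\<^sup>+x. ennreal (G x powr p n) \<partial>M) \<le> 1 + (\<integral>\<^sup>+x. ennreal (F x powr c) \<partial>M)" .
    qed
  qed simp
  finally show ?thesis .
qed

text \<open>The part above \<open>a\<close> is kept separate because the Young-Orlicz function
  dominates powers only for arguments at least \<open>exp 1\<close>.\<close>

lemma (in prob_space) moment_split:
  fixes F :: "'a \<Rightarrow> real"
  assumes [measurable]: "F \<in> borel_measurable M" and "\<And>x. 0 \<le> F x" and "0 \<le> p" and "0 \<le> a"
  shows "(\<integral>\<^sup>+x. ennreal (F x powr p) \<partial>M)
    \<le> ennreal (a powr p) + (\<integral>\<^sup>+x. indicator {x. a \<le> F x} x * ennreal (F x powr p) \<partial>M)"
proof -
  have "(\<integral>\<^sup>+x. ennreal (F x powr p) \<partial>M)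
      \<le> (\<integral>\<^sup>+x. ennreal (a powr p) + indicator {x. a \<le> F x} x * ennreal (F x powr p) \<partial>M)"
  proof (rule nn_integral_mono)
    fix x
    show "ennreal (F x powr p) \<le> ennreal (a powr p) + indicator {x. a \<le> F x} x * ennreal (F x powr p)"
      using assms(2)[of x] assms(3) by (cases "a \<le> F x") (auto intro!: ennreal_leI powr_mono2)
  qed
  also have "\<dots> = ennreal (a powr p) + (\<integral>\<^sup>+x. indicator {x. a \<le> F x} x * ennreal (F x powr p) \<partial>M)"
    by (subst nn_integral_add) (auto simp: emeasure_space_1)
  finally show ?thesis .
qed

context prob_space
begin

text \<open>Where \<open>F x / \<psi>(q)\<close> is at least \<open>exp 1\<close>, its
  \<open>q\<close>-th power is one member of the supremum defining \<open>M_fun\<close>, so that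
  part integrates to at most 1. The rest gives \<open>exp 1 powr q\<close>, and doubling the base
  absorbs the extra 1.\<close>

lemma Orlicz_q_moment:
  fixes F :: "'a \<Rightarrow> real"
  assumes [measurable]: "F \<in> borel_measurable M"
    and nonneg: "\<And>x. 0 \<le> F x"
    and \<psi>: "\<psi> \<in> Psi b" "1 < b" and q: "1 \<le> q" "ereal q < b"
    and M1: "(\<integral>\<^sup>+x. M_fun C \<psi> (F x) \<partial>M) \<le> 1"
  shows "(\<integral>\<^sup>+x. ennreal ((F x / enn2real (\<psi> q)) powr q) \<partial>M) \<le> ennreal ((2 * exp 1) powr q)"
proof -
  define r where "r = enn2real (\<psi> q)"
  have r: "1 \<le> r" using Psi_enn2real_ge_1[OF \<psi> q] by (simp add: r_def)
  have qdom: "q \<in> dom_of \<psi>" using Psi_finite[OF \<psi>] q by simp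
  have "(\<integral>\<^sup>+x. indicator {x. exp 1 \<le> F x / r} x * ennreal ((F x / r) powr q) \<partial>M)
      \<le> (\<integral>\<^sup>+x. M_fun C \<psi> (F x) \<partial>M)"
  proof (rule nn_integral_mono)
    fix x
    show "indicator {x. exp 1 \<le> F x / r} x * ennreal ((F x / r) powr q) \<le> M_fun C \<psi> (F x)"
    proof (cases "exp 1 \<le> F x / r")
      case True
      moreover have "F x / r \<le> F x / 1" using r nonneg[of x] by (intro divide_left_mono) auto
      ultimately have e: "exp 1 \<le> F x" by simp
      then have pos: "0 < F x" by (meson exp_gt_zero less_le_trans)
      have "ennreal ((F x / r) powr q) = ennreal (exp (q * ln (F x) - v_fun \<psi> q))"
        using exp_line_eq[OF pos, of \<psi> q] r by (simp add: r_def)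
      also have "\<dots> \<le> M_fun C \<psi> (F x)"
        using qdom by (subst M_fun_large[OF e]) (auto intro!: SUP_upper)
      finally show ?thesis using True by simp
    qed simp
  qed
  also have "\<dots> \<le> 1" by fact
  finally have I: "(\<integral>\<^sup>+x. indicator {x. exp 1 \<le> F x / r} x * ennreal ((F x / r) powr q) \<partial>M) \<le> 1" .
  have "(\<integral>\<^sup>+x. ennreal ((F x / r) powr q) \<partial>M) \<le> ennreal (exp 1 powr q)
      + (\<integral>\<^sup>+x. indicator {x. exp 1 \<le> F x / r} x * ennreal ((F x / r) powr q) \<partial>M)"
    using nonneg r q by (intro moment_split) auto
  also have "\<dots> \<le> ennreal (exp 1 powr q) + 1" using I by (rule add_left_mono)
  also have "\<dots> \<le> ennreal ((2 * exp 1) powr q)"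
  proof -
    have "1 \<le> exp 1 powr q" using q by (simp add: powr_def)
    moreover have "2 powr 1 \<le> (2::real) powr q" using q by (intro powr_mono) auto
    moreover from this have "2 * exp 1 powr q \<le> 2 powr q * exp 1 powr q"
      by (intro mult_right_mono) auto
    ultimately have "1 + exp 1 powr q \<le> 2 powr q * exp 1 powr q" by linarith
    also have "\<dots> = (2 * exp 1) powr q" by (simp add: powr_mult)
    finally show ?thesis
      by (metis add.commute ennreal_1 ennreal_leI ennreal_plus powr_ge_zero zero_le_one)
  qed
  finally show ?thesis by (simp add: r_def)
qed


text \<open>For \<open>p \<le> q\<close> the power of \<open>G\<close> is interpolated between 1 and
  the \<open>q\<close>-th power, after scaling by \<open>2 * exp 1\<close>. For
  \<open>q < p < b\<close> the comparison \<open>le\<close> applies directly, and a possible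
  \<open>p = b\<close> is reached by \<open>moment_le_endpoint\<close>.\<close>

lemma Orlicz_moments:
  fixes F G :: "'a \<Rightarrow> real"
  assumes [measurable]: "F \<in> borel_measurable M" "G \<in> borel_measurable M"
    and nonneg: "\<And>x. 0 \<le> F x" "\<And>x. 0 \<le> G x"
    and \<psi>: "\<psi> \<in> Psi b" "1 < b" and q: "1 < q" "ereal q < b"
    and Gq: "(\<integral>\<^sup>+x. ennreal (G x powr q) \<partial>M) \<le> ennreal ((2 * exp 1) powr q)"
    and le: "\<And>p. q \<le> p \<Longrightarrow> ereal p < b \<Longrightarrow>
      (\<integral>\<^sup>+x. ennreal (G x powr p) \<partial>M) \<le> (\<integral>\<^sup>+x. ennreal (F x powr p) \<partial>M)"
    and p: "p \<in> dom_of \<psi>"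
  shows "(\<integral>\<^sup>+x. ennreal (G x powr p) \<partial>M) \<le> ennreal (2 * (2 * exp 1) powr p)
    + (\<integral>\<^sup>+x. indicator {x. exp 1 \<le> F x} x * ennreal (F x powr p) \<partial>M)"
    and "p \<le> q \<Longrightarrow> (\<integral>\<^sup>+x. ennreal (G x powr p) \<partial>M) \<le> ennreal (2 * (2 * exp 1) powr p)"
proof -
  define a :: real where "a = 2 * exp 1"
  have a: "1 \<le> a" "0 < a" using exp_ge_add_one_self[of "1::real"] by (simp_all add: a_def)
  show small: "(\<integral>\<^sup>+x. ennreal (G x powr p) \<partial>M) \<le> ennreal (2 * (2 * exp 1) powr p)" if "p \<le> q"
  proof -
    define c where "c = 1 / a powr q"
    have c: "0 \<le> c" by (simp add: c_def)
    have "(\<integral>\<^sup>+x. ennreal (G x powr p) \<partial>M)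
        \<le> (\<integral>\<^sup>+x. ennreal (a powr p) * (1 + ennreal c * ennreal (G x powr q)) \<partial>M)"
    proof (rule nn_integral_mono)
      fix x
      have "G x powr p = a powr p * (G x / a) powr p"
        using nonneg(2)[of x] a by (simp add: powr_divide)
      also have "\<dots> \<le> a powr p * (1 + (G x / a) powr q)"
        using nonneg(2)[of x] a p that by (intro mult_left_mono powr_le_1_plus_powr) auto
      also have "(G x / a) powr q = c * G x powr q"
        using nonneg(2)[of x] a by (simp add: powr_divide c_def)
      finally have "ennreal (G x powr p) \<le> ennreal (a powr p * (1 + c * G x powr q))"
        by (rule ennreal_leI)
      then show "ennreal (G x powr p) \<le> ennreal (a powr p) * (1 + ennreal c * ennreal (G x powr q))"
        using c by (simp add: ennreal_mult)
    qed
    also have "\<dots> = ennreal (a powr p) * (1 + ennreal c * (\<integral>\<^sup>+x. ennreal (G x powr q) \<partial>M))"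
      by (simp add: nn_integral_cmult nn_integral_add emeasure_space_1)
    also have "\<dots> \<le> ennreal (a powr p) * (1 + ennreal c * ennreal (a powr q))"
      using Gq unfolding a_def by (intro mult_left_mono add_left_mono) auto
    also have "ennreal c * ennreal (a powr q) = 1"
      using a by (simp add: c_def flip: ennreal_mult)
    also have "ennreal (a powr p) * (1 + 1) = ennreal (2 * a powr p)"
      by (simp add: ennreal_mult mult.commute)
    finally show ?thesis by (simp add: a_def)
  qed
  show "(\<integral>\<^sup>+x. ennreal (G x powr p) \<partial>M) \<le> ennreal (2 * (2 * exp 1) powr p)
    + (\<integral>\<^sup>+x. indicator {x. exp 1 \<le> F x} x * ennreal (F x powr p) \<partial>M)" (is "_ \<le> _ + ?I")
  proof (cases "p \<le> q")
    case True
    then show ?thesis using small by (simp add: add_increasing2)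
  next
    case False
    have "(\<integral>\<^sup>+x. ennreal (G x powr p) \<partial>M) \<le> 1 + (\<integral>\<^sup>+x. ennreal (F x powr p) \<partial>M)"
    proof (cases "ereal p < b")
      case True
      then show ?thesis using le[of p] False by (simp add: add_increasing)
    next
      case F: False
      then have "b = ereal p" using Psi_dom_le[OF \<psi>, of p] p by auto
      then show ?thesis
        using False q nonneg by (intro moment_le_endpoint[of F G q p] le) auto
    qed
    also have "\<dots> \<le> 1 + (ennreal (exp 1 powr p) + ?I)"
      using nonneg p by (intro add_left_mono moment_split) auto
    also have "\<dots> = ennreal (1 + exp 1 powr p) + ?I"
      by (simp add: add.assoc)
    also have "\<dots> \<le> ennreal (2 * (2 * exp 1) powr p) + ?I"
    proof (intro add_right_mono ennreal_leI)
      have "1 \<le> a powr p" using a p by (intro ge_one_powr_ge_zero) auto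
      moreover have "exp 1 powr p \<le> a powr p" using p by (intro powr_mono2) (auto simp: a_def)
      ultimately show "1 + exp 1 powr p \<le> 2 * (2 * exp 1) powr p" by (simp add: a_def)
    qed
    finally show ?thesis .
  qed
qed

text \<open>Division by \<open>D\<close> gains a factor \<open>1 / D\<close> in every moment, as
  \<open>p \<ge> 1\<close>. With \<open>a = 2 * exp 1\<close> the threshold for \<open>D\<close> is
  \<open>exp 1 * (16 * a * B + 8) + 2 * C * exp 1 * a\<close>: the first \<open>exp 1\<close> pays
  for the covering gap, \<open>8 * B * 2 * a\<close> for the constant parts of the moments, 8 for
  the integral of \<open>M_fun\<close> at \<open>F\<close>, and the last term for the quadratic
  branch.\<close>

lemma Orlicz_transfer:
  fixes F G :: "'a \<Rightarrow> real"
  assumes [measurable]: "F \<in> borel_measurable M" "G \<in> borel_measurable M"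
    and nonneg: "\<And>x. 0 \<le> F x" "\<And>x. 0 \<le> G x"
    and \<psi>: "\<psi> \<in> Psi b" "1 < b" and q: "1 < q" "ereal q < b"
    and Gq: "(\<integral>\<^sup>+x. ennreal (G x powr q) \<partial>M) \<le> ennreal ((2 * exp 1) powr q)"
    and le: "\<And>p. q \<le> p \<Longrightarrow> ereal p < b \<Longrightarrow>
      (\<integral>\<^sup>+x. ennreal (G x powr p) \<partial>M) \<le> (\<integral>\<^sup>+x. ennreal (F x powr p) \<partial>M)"
    and M1: "(\<integral>\<^sup>+x. M_fun C \<psi> (F x) \<partial>M) \<le> 1"
    and C: "0 < C" and B: "1 \<le> B" "\<And>p. p \<in> dom_of \<psi> \<Longrightarrow> exp (- v_fun \<psi> p) \<le> B"
    and D: "exp 1 * (32 * exp 1 * B + 8) + 4 * C * exp 1 * exp 1 \<le> D"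
  shows "(\<integral>\<^sup>+x. M_fun C \<psi> (G x / D) \<partial>M) \<le> 1"
proof -
  define a :: real where "a = 2 * exp 1"
  define v where "v = v_fun \<psi>"
  have e: "1 \<le> exp (1::real)" by simp
  have a: "1 \<le> a" "0 < a" using e by (simp_all add: a_def del: one_le_exp_iff)
  have one: "1 \<in> dom_of \<psi>" using Psi_finite[OF \<psi>, of 1] \<psi> by (simp add: one_ereal_def)
  then have dom: "dom_of \<psi> \<noteq> {}" by blast
  \<comment> \<open>Lets \<open>scale\<close> below be used with \<open>z = a\<close>, since a power
    with \<open>p \<ge> 1\<close> shrinks \<open>a / D\<close> only if this ratio is at most
    1.\<close>
  have aD: "a \<le> D"
  proof -
    have "a * 1 \<le> a * (exp 1 * (16 * B))"
      using a e B mult_mono[OF e, of 1 "16 * B"] by (intro mult_left_mono) auto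
    moreover have "a * (exp 1 * (16 * B)) = exp 1 * (32 * exp 1 * B)" by (simp add: a_def)
    moreover have "0 < 4 * C * exp 1 * exp 1" "0 < exp (1::real)" using C by auto
    ultimately show ?thesis using D by (simp only: distrib_left)
  qed
  then have D0: "0 < D" "1 \<le> D" using a by auto
  define I where "I p = (\<integral>\<^sup>+x. indicator {x. exp 1 \<le> F x} x * ennreal (F x powr p) \<partial>M)" for p
  have mom: "(\<integral>\<^sup>+x. ennreal ((G x / D) powr p) \<partial>M) \<le> ennreal (1 / D) * (ennreal (2 * a) + I p)"
    if p: "p \<in> dom_of \<psi>" for p
  proof -
    have scale: "z powr p / D powr p \<le> z / D" if "0 < z" "z \<le> D" for z
    proof -
      have "(z / D) powr p \<le> (z / D) powr 1" using that p D0 by (intro powr_mono') auto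
      then show ?thesis using that D0 by (simp add: powr_divide)
    qed
    define c where "c = 1 / D powr p"
    have c: "0 \<le> c" "c * (2 * a powr p) \<le> 1 / D * (2 * a)" "c \<le> 1 / D"
      using scale[of a] scale[of 1] a aD D0 by (auto simp: c_def)
    have "(\<integral>\<^sup>+x. ennreal ((G x / D) powr p) \<partial>M) = (\<integral>\<^sup>+x. ennreal c * ennreal (G x powr p) \<partial>M)"
      using nonneg D0 c by (intro nn_integral_cong) (simp add: powr_divide c_def flip: ennreal_mult)
    also have "\<dots> = ennreal c * (\<integral>\<^sup>+x. ennreal (G x powr p) \<partial>M)"
      by (intro nn_integral_cmult) measurable
    also have "\<dots> \<le> ennreal c * (ennreal (2 * a powr p) + I p)"
      using Orlicz_moments(1)[OF assms(1-10) p] unfolding a_def I_def by (intro mult_left_mono) auto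
    also have "\<dots> = ennreal (c * (2 * a powr p)) + ennreal c * I p"
      using c by (simp add: distrib_left ennreal_mult)
    also have "\<dots> \<le> ennreal (1 / D * (2 * a)) + ennreal (1 / D) * I p"
      using c by (intro add_mono mult_right_mono ennreal_leI) auto
    also have "\<dots> = ennreal (1 / D) * (ennreal (2 * a) + I p)"
      using D0 a by (simp add: distrib_left flip: ennreal_mult)
    finally show ?thesis .
  qed
  obtain r :: "nat \<Rightarrow> real" where r: "range r \<subseteq> dom_of \<psi>"
    and r_sup: "\<And>u. (SUP p\<in>dom_of \<psi>. ennreal (exp (p * u - v p)))
      \<le> (SUP n. ennreal (exp (r n * u - v (r n))))"
    using SUP_lines_countable[OF dom, of v] by blast
  define Y where "Y x = G x / D" for x
  have [measurable]: "Y \<in> borel_measurable M" unfolding Y_def by measurable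
  \<comment> \<open>Finite suprema on the set where the large branch is active; they increase with
    \<open>n\<close>, and the bound from \<open>sparse_envelope\<close> does not depend on the
    number of lines.\<close>
  define h where "h n x = indicator {x. exp 1 \<le> Y x} x *
    (SUP i\<in>{..n}. ennreal (exp (r i * ln (Y x) - v (r i))))" for n :: nat and x
  have [measurable]: "h n \<in> borel_measurable M" for n
    unfolding h_def by measurable
  have inc: "incseq h"
    unfolding incseq_def le_fun_def h_def by (auto intro!: mult_left_mono SUP_subset_mono)
  have h_int: "(\<integral>\<^sup>+x. h n x \<partial>M) \<le> ennreal (exp 1 / D * (16 * a * B + 8))" for n
  proof -
    obtain T where T: "T \<subseteq> r ` {..n}"
      and cover: "\<And>u. \<exists>p\<in>T. \<forall>q\<in>r ` {..n}. q * u - v q \<le> p * u - v p + 1"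
      and sparse: "\<And>u. \<exists>q\<in>r ` {..n}. (\<Sum>p\<in>T. exp (p * u - v p)) \<le> 8 * exp (q * u - v q)"
      using sparse_envelope[of "r ` {..n}" v] by auto
    have finT: "finite T" using T finite_subset by blast
    have Tdom: "p \<in> dom_of \<psi>" if "p \<in> T" for p using T r that by blast
    \<comment> \<open>The covering gap of 1 in the exponent becomes the factor
      \<open>exp 1\<close>.\<close>
    have "h n x \<le> (\<Sum>p\<in>T. ennreal (exp 1 * exp (- v p)) * ennreal (Y x powr p))" for x
    proof (cases "exp 1 \<le> Y x")
      case True
      then have Y: "0 < Y x" by (meson exp_gt_zero less_le_trans)
      have "ennreal (exp (r i * ln (Y x) - v (r i)))
          \<le> (\<Sum>p\<in>T. ennreal (exp 1 * exp (- v p)) * ennreal (Y x powr p))" if "i \<le> n" for i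
      proof -
        obtain p where p: "p \<in> T" "\<forall>q\<in>r ` {..n}. q * ln (Y x) - v q \<le> p * ln (Y x) - v p + 1"
          using cover[of "ln (Y x)"] by blast
        have "r i * ln (Y x) - v (r i) \<le> p * ln (Y x) - v p + 1"
          using p(2) that by simp
        then have "exp (r i * ln (Y x) - v (r i)) \<le> exp (p * ln (Y x) - v p + 1)" by simp
        also have "\<dots> = exp 1 * exp (- v p) * Y x powr p"
          using Y by (simp add: powr_def flip: exp_add)
        finally have "ennreal (exp (r i * ln (Y x) - v (r i)))
            \<le> ennreal (exp 1 * exp (- v p)) * ennreal (Y x powr p)"
          by (simp add: ennreal_leI flip: ennreal_mult)
        also have "\<dots> \<le> (\<Sum>p\<in>T. ennreal (exp 1 * exp (- v p)) * ennreal (Y x powr p))"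
          using finT p(1) by (intro member_le_sum) auto
        finally show ?thesis .
      qed
      then show ?thesis using True unfolding h_def by (auto intro!: SUP_least)
    qed (simp add: h_def)
    then have "(\<integral>\<^sup>+x. h n x \<partial>M)
        \<le> (\<integral>\<^sup>+x. (\<Sum>p\<in>T. ennreal (exp 1 * exp (- v p)) * ennreal (Y x powr p)) \<partial>M)"
      by (intro nn_integral_mono) auto
    also have "\<dots> = (\<Sum>p\<in>T. ennreal (exp 1 * exp (- v p)) * (\<integral>\<^sup>+x. ennreal (Y x powr p) \<partial>M))"
      by (simp add: nn_integral_sum nn_integral_cmult)
    also have "\<dots> \<le> (\<Sum>p\<in>T. ennreal (exp 1 * exp (- v p)) * (ennreal (1 / D) * (ennreal (2 * a) + I p)))"
      unfolding Y_def using mom Tdom by (intro sum_mono mult_left_mono) auto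
    also have "\<dots> = (\<Sum>p\<in>T. ennreal (exp 1 / D) * (ennreal (exp (- v p)) * ennreal (2 * a) + ennreal (exp (- v p)) * I p))"
    proof (rule sum.cong)
      fix p
      have "ennreal (exp 1 * exp (- v p)) * ennreal (1 / D) = ennreal (exp 1 / D) * ennreal (exp (- v p))"
        using D0 by (simp flip: ennreal_mult)
      then show "ennreal (exp 1 * exp (- v p)) * (ennreal (1 / D) * (ennreal (2 * a) + I p)) =
          ennreal (exp 1 / D) * (ennreal (exp (- v p)) * ennreal (2 * a) + ennreal (exp (- v p)) * I p)"
        by (metis distrib_left mult.assoc)
    qed simp
    also have "\<dots> = ennreal (exp 1 / D) * ((\<Sum>p\<in>T. ennreal (exp (- v p))) * ennreal (2 * a)
        + (\<Sum>p\<in>T. ennreal (exp (- v p)) * I p))"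
      by (simp only: sum_distrib_left[symmetric] sum.distrib sum_distrib_right[symmetric])
    also have "\<dots> \<le> ennreal (exp 1 / D) * (ennreal (8 * B) * ennreal (2 * a) + 8)"
    proof (intro mult_left_mono add_mono mult_right_mono)
      \<comment> \<open>At \<open>u = 0\<close> the sparse bound controls the sum of the
        coefficients \<open>exp (- v p)\<close>.\<close>
      obtain q' where "q' \<in> r ` {..n}" "(\<Sum>p\<in>T. exp (p * 0 - v p)) \<le> 8 * exp (q' * 0 - v q')"
        using sparse by blast
      moreover from this have "exp (- v q') \<le> B" using B r by (auto simp: v_def)
      ultimately have "(\<Sum>p\<in>T. exp (- v p)) \<le> 8 * B" by simp
      then show "(\<Sum>p\<in>T. ennreal (exp (- v p))) \<le> ennreal (8 * B)"
        by (simp add: sum_ennreal ennreal_leI)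
      \<comment> \<open>At \<open>u = ln (F x)\<close> the same bound puts the whole sum below
        \<open>8 * M_fun C \<psi> (F x)\<close>, so its integral is at most 8.\<close>
      define s where "s x = indicator {x. exp 1 \<le> F x} x * (\<Sum>p\<in>T. ennreal (exp (- v p)) * ennreal (F x powr p))" for x
      have [measurable]: "s \<in> borel_measurable M" unfolding s_def by measurable
      have "(\<Sum>p\<in>T. ennreal (exp (- v p)) * I p) = (\<integral>\<^sup>+x. s x \<partial>M)"
        unfolding I_def s_def
        by (simp add: nn_integral_sum nn_integral_cmult[symmetric] sum_distrib_left mult.left_commute)
      also have "\<dots> = 8 * (ennreal (1/8) * (\<integral>\<^sup>+x. s x \<partial>M))"
        by (simp add: mult.assoc[symmetric] flip: ennreal_numeral ennreal_mult)
      also have "ennreal (1/8) * (\<integral>\<^sup>+x. s x \<partial>M) = (\<integral>\<^sup>+x. ennreal (1/8) * s x \<partial>M)"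
        by (simp add: nn_integral_cmult)
      also have "\<dots> \<le> (\<integral>\<^sup>+x. M_fun C \<psi> (F x) \<partial>M)"
      proof (rule nn_integral_mono)
        fix x
        show "ennreal (1/8) * s x \<le> M_fun C \<psi> (F x)"
        proof (cases "exp 1 \<le> F x")
          case True
          then have F: "0 < F x" by (meson exp_gt_zero less_le_trans)
          obtain q' where q': "q' \<in> r ` {..n}"
            "(\<Sum>p\<in>T. exp (p * ln (F x) - v p)) \<le> 8 * exp (q' * ln (F x) - v q')"
            using sparse by blast
          have "s x = (\<Sum>p\<in>T. ennreal (exp (p * ln (F x) - v p)))"
            using True F by (simp add: s_def powr_def flip: ennreal_mult exp_add)
          then have "s x = ennreal (\<Sum>p\<in>T. exp (p * ln (F x) - v p))"
            by (simp add: sum_ennreal)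
          then have "ennreal (1/8) * s x = ennreal (1/8 * (\<Sum>p\<in>T. exp (p * ln (F x) - v p)))"
            by (simp add: ennreal_mult sum_nonneg del: times_divide_eq_left mult_1)
          also have "\<dots> \<le> ennreal (exp (q' * ln (F x) - v q'))"
            using q'(2) by (intro ennreal_leI) simp
          also have "\<dots> \<le> M_fun C \<psi> (F x)"
            unfolding v_def M_fun_large[OF True dom] using q' r by (intro SUP_upper) auto
          finally show ?thesis .
        qed (simp add: s_def)
      qed
      also have "\<dots> \<le> 1" by fact
      finally show "(\<Sum>p\<in>T. ennreal (exp (- v p)) * I p) \<le> 8"
        by (simp add: mult_left_mono)
    qed auto
    also have "\<dots> = ennreal (exp 1 / D * (16 * a * B + 8))"
      using D0 a B by (simp add: ennreal_mult[symmetric] ennreal_plus[symmetric] algebra_simps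
          del: ennreal_plus flip: ennreal_numeral)
    finally show ?thesis .
  qed
  have "(\<integral>\<^sup>+x. M_fun C \<psi> (G x / D) \<partial>M) \<le> (\<integral>\<^sup>+x. (SUP n. h n x) + ennreal (C * exp 1 / D) * ennreal (G x powr 1) \<partial>M)"
  proof (rule nn_integral_mono)
    fix x
    show "M_fun C \<psi> (G x / D) \<le> (SUP n. h n x) + ennreal (C * exp 1 / D) * ennreal (G x powr 1)"
    proof (cases "exp 1 \<le> Y x")
      case True
      have "M_fun C \<psi> (Y x) \<le> (SUP n. ennreal (exp (r n * ln (Y x) - v (r n))))"
        using r_sup unfolding v_def M_fun_large[OF True dom] .
      also have "\<dots> \<le> (SUP n. h n x)"
        using True by (intro SUP_mono) (auto simp: h_def intro!: SUP_upper)
      finally show ?thesis by (simp add: Y_def add_increasing2)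
    next
      case False
      have Y: "0 \<le> Y x" using nonneg D0 by (simp add: Y_def)
      \<comment> \<open>One factor \<open>Y x\<close> is traded for \<open>exp 1\<close>: the first
        moment is controlled, while for \<open>b < 2\<close> the second may be infinite.\<close>
      have "C * (Y x)\<^sup>2 \<le> C * (exp 1 * Y x)"
        unfolding power2_eq_square using False Y C by (intro mult_left_mono mult_right_mono) auto
      also have "\<dots> = C * exp 1 / D * G x" by (simp add: Y_def)
      finally have "ennreal (C * (Y x)\<^sup>2) \<le> ennreal (C * exp 1 / D) * ennreal (G x powr 1)"
        using nonneg C D0 by (simp add: ennreal_leI flip: ennreal_mult)
      moreover have "M_fun C \<psi> (Y x) = ennreal (C * (Y x)\<^sup>2)"
        using False Y by (simp add: M_fun_def)
      ultimately show ?thesis by (simp add: Y_def add_increasing)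
    qed
  qed
  also have "\<dots> = (SUP n. \<integral>\<^sup>+x. h n x \<partial>M) + ennreal (C * exp 1 / D) * (\<integral>\<^sup>+x. ennreal (G x powr 1) \<partial>M)"
    using inc by (simp add: nn_integral_add nn_integral_cmult nn_integral_monotone_convergence_SUP del: powr_one_gt_zero_iff powr_one' powr_one)
  also have "\<dots> \<le> ennreal (exp 1 / D * (16 * a * B + 8)) + ennreal (C * exp 1 / D) * ennreal (2 * a powr 1)"
    using Orlicz_moments(2)[OF assms(1-10) one] q h_int unfolding a_def
    by (intro add_mono mult_left_mono SUP_least) auto
  also have "\<dots> = ennreal ((exp 1 * (16 * a * B + 8) + 2 * C * exp 1 * a) / D)"
    using D0 a B C by (simp add: ennreal_mult[symmetric] ennreal_plus[symmetric] add_divide_distrib algebra_simps del: ennreal_plus)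
  also have "\<dots> \<le> ennreal 1"
    using D D0 by (intro ennreal_leI) (simp add: a_def algebra_simps)
  finally show ?thesis by simp
qed

end

section \<open>Norm estimates\<close>

text \<open>If \<open>R = 0\<close>, any member of \<open>I\<close> forces \<open>x = 0\<close>;
  otherwise division by the finite \<open>R\<close> isolates the infimum. It passes bounds for
  single \<open>q\<close> or \<open>k\<close> to \<open>K_const\<close> and to the Luxemburg
  norm.\<close>

lemma le_INF_mult_ennreal:
  fixes x R :: ennreal
  assumes "I \<noteq> {}" and "R < \<top>" and "\<And>i. i \<in> I \<Longrightarrow> x \<le> f i * R"
  shows "x \<le> (INF i\<in>I. f i) * R"
proof (cases "R = 0")
  case True
  then show ?thesis using assms by fastforce
next
  case False
  then have "x / R \<le> (INF i\<in>I. f i)"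
    using assms by (intro INF_greatest divide_le_posI_ennreal) (auto simp: zero_less_iff_neq_zero mult.commute)
  then have "R * (x / R) \<le> R * (INF i\<in>I. f i)" by (rule mult_left_mono) simp
  moreover have "R * (x / R) = x"
    using False assms(2) by (simp add: ennreal_times_divide mult.commute[of R] ennreal_mult_divide_eq)
  ultimately show ?thesis by (simp add: mult.commute)
qed

lemma Lp_norm_le_iff:
  assumes "0 < p" and "0 \<le> a"
  shows "Lp_norm M p f \<le> ennreal a \<longleftrightarrow> (\<integral>\<^sup>+x. ennreal (norm (f x) powr p) \<partial>M) \<le> ennreal (a powr p)"
proof (cases "\<integral>\<^sup>+x. ennreal (norm (f x) powr p) \<partial>M")
  case (real i)
  have "i powr (1 / p) \<le> a \<longleftrightarrow> i \<le> a powr p"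
  proof
    assume "i powr (1 / p) \<le> a"
    then have "(i powr (1 / p)) powr p \<le> a powr p" using assms by (intro powr_mono2) auto
    then show "i \<le> a powr p" using real assms by (simp add: powr_powr)
  next
    assume "i \<le> a powr p"
    then have "i powr (1 / p) \<le> (a powr p) powr (1 / p)" using assms real by (intro powr_mono2) auto
    then show "i powr (1 / p) \<le> a" using assms by (simp add: powr_powr)
  qed
  then show ?thesis using real assms by (simp add: Lp_norm_def)
qed (simp add: Lp_norm_def top_unique)

lemma nn_integral_powr_Lp_norm:
  assumes "0 < p" and "0 \<le> a" and "Lp_norm M p f = ennreal a"
  shows "(\<integral>\<^sup>+x. ennreal (norm (f x) powr p) \<partial>M) = ennreal (a powr p)"
proof (cases "\<integral>\<^sup>+x. ennreal (norm (f x) powr p) \<partial>M")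
  case (real i)
  then have "i powr (1 / p) = a" using assms by (simp add: Lp_norm_def)
  then have "a powr p = i" using real assms by (auto simp: powr_powr)
  then show ?thesis using real by simp
next
  case top
  then show ?thesis using assms by (simp add: Lp_norm_def)
qed

lemma Lp_norm_eq_0_AE:
  assumes [measurable]: "f \<in> borel_measurable M" and "0 < p" and "Lp_norm M p f = 0"
  shows "AE x in M. f x = 0"
proof -
  have "(\<integral>\<^sup>+x. ennreal (norm (f x) powr p) \<partial>M) = 0"
    using nn_integral_powr_Lp_norm[of p 0 M f] assms by simp
  then show ?thesis by (simp add: nn_integral_0_iff_AE)
qed

text \<open>Lyapunov's inequality: with \<open>y = norm (f x) / a\<close>, where \<open>a\<close> is
  the norm of order \<open>q\<close>, and \<open>t = p / q\<close>, Young's inequality gives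
  \<open>y powr p \<le> t * y powr q + (1 - t)\<close>, and the right side integrates to 1. The
  normalisation requires \<open>a = 0\<close> to be treated separately.\<close>

lemma (in prob_space) Lp_norm_mono:
  assumes [measurable]: "f \<in> borel_measurable M" and "0 < p" and "p \<le> q"
  shows "Lp_norm M p f \<le> Lp_norm M q f"
proof (cases "Lp_norm M q f")
  case (real a)
  have q: "0 < q" using assms by simp
  have Iq: "(\<integral>\<^sup>+x. ennreal (norm (f x) powr q) \<partial>M) = ennreal (a powr q)"
    by (rule nn_integral_powr_Lp_norm) (use real q in auto)
  have "(\<integral>\<^sup>+x. ennreal (norm (f x) powr p) \<partial>M) \<le> ennreal (a powr p)"
  proof (cases "a = 0")
    case True
    then have "AE x in M. f x = 0" using Lp_norm_eq_0_AE[OF assms(1) q] real by simp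
    then have "(\<integral>\<^sup>+x. ennreal (norm (f x) powr p) \<partial>M) = 0"
      by (subst nn_integral_0_iff_AE) auto
    then show ?thesis by simp
  next
    case False
    then have a: "0 < a" using real by simp
    define t where "t = p / q"
    have t: "0 \<le> t" "t \<le> 1" using assms q by (auto simp: t_def)
    define c where "c = a powr p * (t / a powr q)"
    have c: "0 \<le> c" using t by (simp add: c_def)
    have "(\<integral>\<^sup>+x. ennreal (norm (f x) powr p) \<partial>M)
        \<le> (\<integral>\<^sup>+x. ennreal (a powr p * (1 - t)) + ennreal c * ennreal (norm (f x) powr q) \<partial>M)"
    proof (rule nn_integral_mono)
      fix x
      have "norm (f x) powr p \<le> a powr p * (1 - t) + c * norm (f x) powr q"
      proof (cases "f x = 0")
        case True
        then show ?thesis using t by simp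
      next
        case False
        define y where "y = norm (f x) / a"
        have y: "0 < y" using a False by (simp add: y_def)
        have "y powr p = (y powr q) powr t * 1 powr (1 - t)"
          using q by (simp add: powr_powr t_def)
        also have "\<dots> \<le> t * y powr q + (1 - t) * 1"
          using t y by (intro Youngs_inequality_0) auto
        finally have "a powr p * y powr p \<le> a powr p * (t * y powr q + (1 - t))"
          by (intro mult_left_mono) auto
        moreover have "a powr p * y powr p = norm (f x) powr p"
          using a by (simp add: y_def powr_divide)
        moreover have "a powr p * (t * y powr q + (1 - t)) = a powr p * (1 - t) + c * norm (f x) powr q"
          using a by (simp add: y_def c_def powr_divide field_simps)
        ultimately show ?thesis by simp
      qed
      then show "ennreal (norm (f x) powr p)
          \<le> ennreal (a powr p * (1 - t)) + ennreal c * ennreal (norm (f x) powr q)"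
        using t c by (simp add: ennreal_leI flip: ennreal_mult ennreal_plus)
    qed
    also have "\<dots> = ennreal (a powr p * (1 - t)) + ennreal c * ennreal (a powr q)"
      by (simp add: nn_integral_add nn_integral_cmult Iq emeasure_space_1)
    also have "\<dots> = ennreal (a powr p)"
      using t c a by (simp add: c_def algebra_simps flip: ennreal_mult ennreal_plus)
    finally show ?thesis .
  qed
  then show ?thesis using real assms by (simp add: Lp_norm_le_iff)
qed simp

lemma nn_integral_powr_scale:
  fixes h :: "'a \<Rightarrow> 'b::{real_normed_field,euclidean_space}"
  assumes [measurable]: "h \<in> borel_measurable M" and "0 < c"
  shows "(\<integral>\<^sup>+x. ennreal ((norm (h x) / c) powr p) \<partial>M)
    = ennreal (1 / c powr p) * (\<integral>\<^sup>+x. ennreal (norm (h x) powr p) \<partial>M)"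
proof -
  have "(\<integral>\<^sup>+x. ennreal ((norm (h x) / c) powr p) \<partial>M)
      = (\<integral>\<^sup>+x. ennreal (1 / c powr p) * ennreal (norm (h x) powr p) \<partial>M)"
    using assms by (intro nn_integral_cong) (simp add: powr_divide flip: ennreal_mult)
  then show ?thesis by (simp add: nn_integral_cmult)
qed

text \<open>Recasts a norm bound with factor \<open>A\<close> as the constant-free comparison of
  moments that \<open>Orlicz_transfer\<close> expects.\<close>

lemma nn_integral_powr_scaled_le:
  assumes [measurable]: "f \<in> borel_measurable M" "g \<in> borel_measurable M"
    and p: "0 < p" and A: "0 < A" and k: "0 < k"
    and le: "Lp_norm M p g \<le> ennreal A * Lp_norm M p f" and fin: "Lp_norm M p f < \<top>"
  shows "(\<integral>\<^sup>+x. ennreal ((norm (g x) / (A * k)) powr p) \<partial>M)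
    \<le> (\<integral>\<^sup>+x. ennreal ((norm (f x) / k) powr p) \<partial>M)"
proof -
  obtain s where s: "0 \<le> s" "Lp_norm M p f = ennreal s" using fin by (cases "Lp_norm M p f") auto
  have "Lp_norm M p g \<le> ennreal (A * s)" using le s A by (simp add: ennreal_mult)
  then have "(\<integral>\<^sup>+x. ennreal (norm (g x) powr p) \<partial>M) \<le> ennreal ((A * s) powr p)"
    using p A s by (simp add: Lp_norm_le_iff)
  then have "(\<integral>\<^sup>+x. ennreal ((norm (g x) / (A * k)) powr p) \<partial>M)
      \<le> ennreal (1 / (A * k) powr p) * ennreal ((A * s) powr p)"
    using A k by (subst nn_integral_powr_scale) (auto intro!: mult_left_mono)
  also have "\<dots> = ennreal (1 / k powr p) * ennreal (s powr p)"
    using A k s by (simp add: powr_mult flip: ennreal_mult)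
  also have "\<dots> = (\<integral>\<^sup>+x. ennreal ((norm (f x) / k) powr p) \<partial>M)"
    using nn_integral_powr_Lp_norm[OF p s] k by (subst nn_integral_powr_scale) auto
  finally show ?thesis .
qed

section \<open>Grand Lebesgue norms and the constant \<open>K_const\<close>\<close>

lemma Lp_norm_le_GLS_norm:
  assumes \<psi>: "\<psi> \<in> Psi b" "1 < b" and p: "1 \<le> p" "ereal p < b"
  shows "Lp_norm M p f \<le> GLS_norm M b \<psi> f * \<psi> p"
proof -
  have "Lp_norm M p f / \<psi> p \<le> GLS_norm M b \<psi> f"
    unfolding GLS_norm_def using p by (intro SUP_upper) auto
  then have "\<psi> p * (Lp_norm M p f / \<psi> p) \<le> \<psi> p * GLS_norm M b \<psi> f" by (rule mult_left_mono) simp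
  moreover have "\<psi> p * (Lp_norm M p f / \<psi> p) = Lp_norm M p f"
    using Psi_finite[OF \<psi> p] Psi_pos[OF \<psi>, of p] p
    by (simp add: ennreal_times_divide mult.commute[of "\<psi> p"] ennreal_mult_divide_eq)
  ultimately show ?thesis by (simp add: mult.commute)
qed

lemma GLS_norm_le:
  assumes \<psi>: "\<psi> \<in> Psi b" "1 < b"
    and "\<And>p. 1 \<le> p \<Longrightarrow> ereal p < b \<Longrightarrow> Lp_norm M p f \<le> R * \<psi> p"
  shows "GLS_norm M b \<psi> f \<le> R"
  unfolding GLS_norm_def using assms(3) Psi_pos[OF \<psi>]
  by (intro SUP_least divide_le_posI_ennreal) (auto simp: mult.commute)

lemma open_interval_nonempty:
  assumes "1 < b"
  shows "{q. 1 < q \<and> ereal q < b} \<noteq> {}"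
  using ereal_dense2[OF assms] by (auto simp: one_ereal_def)

lemma K_const_finite:
  assumes \<psi>: "\<psi> \<in> Psi b" "1 < b"
  shows "K_const l \<psi> b < \<top>"
proof -
  obtain q where q: "1 < q" "ereal q < b" using open_interval_nonempty[OF \<psi>(2)] by auto
  have "K_const l \<psi> b \<le> ennreal (q powr l) * \<psi> q / ennreal ((q - 1) powr l)"
    unfolding K_const_def using q by (intro INF_lower) auto
  also have "\<dots> < \<top>"
    using Psi_finite[OF \<psi>, of q] q
    by (auto simp: ennreal_divide_eq_top_iff ennreal_mult_eq_top_iff less_top[symmetric])
  finally show ?thesis .
qed

lemma ratio_powr_antimono:
  fixes p q l :: real
  assumes "1 < q" and "q \<le> p" and "0 \<le> l"
  shows "p powr l / (p - 1) powr l \<le> q powr l / (q - 1) powr l"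
proof -
  have "p / (p - 1) \<le> q / (q - 1)" using assms by (simp add: field_simps)
  then have "(p / (p - 1)) powr l \<le> (q / (q - 1)) powr l" using assms by (intro powr_mono2) auto
  then show ?thesis using assms by (simp add: powr_divide)
qed

lemma K_term_eq:
  assumes "1 < q"
  shows "ennreal (q powr l) * x / ennreal ((q - 1) powr l) = ennreal (q powr l / (q - 1) powr l) * x"
  using assms by (simp add: divide_ennreal[symmetric] divide_ennreal_def mult_ac)

text \<open>Both parts of the theorem use this: \<open>R\<close> is \<open>Z\<close> times the norm
  of \<open>f\<close> in the first and \<open>Z\<close> in the second. As \<open>q > 1\<close>, the
  exponent \<open>p = 1\<close>, where no bound is given, falls into the case
  \<open>p \<le> q\<close>.\<close>

lemma (in prob_space) GLS_norm_le_K_const: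
  assumes \<psi>: "\<psi> \<in> Psi b" "1 < b" and l: "0 \<le> l" and R: "R < \<top>"
    and g: "g \<in> borel_measurable M"
    and le: "\<And>p. 1 < p \<Longrightarrow> ereal p < b \<Longrightarrow>
      Lp_norm M p g \<le> ennreal (p powr l / (p - 1) powr l) * R * \<psi> p"
  shows "GLS_norm M b \<psi> g \<le> K_const l \<psi> b * R"
  unfolding K_const_def
proof (rule le_INF_mult_ennreal[OF open_interval_nonempty[OF \<psi>(2)] R])
  fix q assume "q \<in> {q. 1 < q \<and> ereal q < b}"
  then have q: "1 < q" "ereal q < b" by auto
  define c where "c = ennreal (q powr l / (q - 1) powr l)"
  show "GLS_norm M b \<psi> g \<le> ennreal (q powr l) * \<psi> q / ennreal ((q - 1) powr l) * R"
    unfolding K_term_eq[OF q(1)] c_def[symmetric]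
  proof (rule GLS_norm_le[OF \<psi>])
    fix p assume p: "1 \<le> p" "ereal p < b"
    show "Lp_norm M p g \<le> c * \<psi> q * R * \<psi> p"
    proof (cases "p \<le> q")
      case True
      have "Lp_norm M p g \<le> Lp_norm M q g" using g p True by (intro Lp_norm_mono) auto
      also have "\<dots> \<le> c * \<psi> q * R * 1" using le[OF q] by (simp add: c_def mult_ac)
      also have "\<dots> \<le> c * \<psi> q * R * \<psi> p" using Psi_ge_1[OF \<psi> p] by (intro mult_left_mono) auto
      finally show ?thesis .
    next
      case False
      then have "Lp_norm M p g \<le> ennreal (p powr l / (p - 1) powr l) * R * \<psi> p" using le p q by simp
      also have "\<dots> \<le> c * R * \<psi> p"
        unfolding c_def using ratio_powr_antimono[of q p l] False q l
        by (intro mult_right_mono ennreal_leI) auto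
      also have "\<dots> = c * 1 * R * \<psi> p" by simp
      also have "\<dots> \<le> c * \<psi> q * R * \<psi> p"
        using Psi_ge_1[OF \<psi>, of q] q by (intro mult_right_mono mult_left_mono) auto
      finally show ?thesis .
    qed
  qed
qed

section \<open>Luxemburg norms and approximate monotonicity of \<open>M_fun\<close>\<close>

lemma Orlicz_norm_le:
  assumes "0 < k" and "(\<integral>\<^sup>+x. \<Phi> (norm (f x) / k) \<partial>M) \<le> 1"
  shows "Orlicz_norm M \<Phi> f \<le> ennreal k"
  unfolding Orlicz_norm_def using assms by (intro INF_lower) auto

lemma Orlicz_norm_finiteD:
  assumes "Orlicz_norm M \<Phi> f < \<top>"
  obtains k where "0 < k" and "(\<integral>\<^sup>+x. \<Phi> (norm (f x) / k) \<partial>M) \<le> 1"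
  using assms unfolding Orlicz_norm_def by (auto simp: INF_less_iff)

text \<open>Every positive \<open>k\<close> is admissible because \<open>M_fun\<close> vanishes at
  0. This settles \<open>Z = 0\<close>, where no positive scaling factor is at hand.\<close>

lemma Orlicz_norm_AE_zero:
  assumes "AE x in M. f x = 0"
  shows "Orlicz_norm M (M_fun C \<psi>) f = 0"
proof -
  have "Orlicz_norm M (M_fun C \<psi>) f \<le> 0 + ennreal e" if "0 < e" for e
  proof -
    have "(\<integral>\<^sup>+x. M_fun C \<psi> (norm (f x) / e) \<partial>M) = (\<integral>\<^sup>+x. 0 \<partial>M)"
      using assms by (intro nn_integral_cong_AE) (auto simp: M_fun_def)
    then show ?thesis using that by (simp add: Orlicz_norm_le)
  qed
  then have "Orlicz_norm M (M_fun C \<psi>) f \<le> 0" by (rule ennreal_le_epsilon)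
  then show ?thesis by simp
qed

lemma M_fun_small: "0 \<le> y \<Longrightarrow> y < exp 1 \<Longrightarrow> M_fun C \<psi> y = ennreal (C * y\<^sup>2)"
  by (simp add: M_fun_def)

text \<open>For large \<open>C\<close> the function may jump down at \<open>exp 1\<close>, so it is
  monotone only up to a dilation \<open>S\<close>. The critical case is
  \<open>y / S < exp 1 \<le> y'\<close>: there the quadratic branch is bounded linearly and compared
  with the member \<open>p = 1\<close> of the supremum, which dictates
  \<open>C * exp 1 * r\<close>.\<close>

lemma M_fun_shrink:
  assumes \<psi>: "\<psi> \<in> Psi b" "1 < b" and C: "0 < C"
  obtains S where "1 \<le> S"
    and "\<And>y y'. 0 \<le> y \<Longrightarrow> y \<le> y' \<Longrightarrow> M_fun C \<psi> (y / S) \<le> M_fun C \<psi> y'"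
proof -
  define r where "r = enn2real (\<psi> 1)"
  have b1: "ereal 1 < b" using \<psi> by (simp add: one_ereal_def)
  have r: "1 \<le> r" using Psi_enn2real_ge_1[OF \<psi> order_refl b1] by (simp add: r_def)
  have one: "1 \<in> dom_of \<psi>" using Psi_finite[OF \<psi> order_refl b1] by simp
  then have dom: "dom_of \<psi> \<noteq> {}" by blast
  define S where "S = max 1 (C * exp 1 * r)"
  have S: "1 \<le> S" "C * exp 1 * r \<le> S" by (auto simp: S_def)
  have "M_fun C \<psi> (y / S) \<le> M_fun C \<psi> y'" if y: "0 \<le> y" "y \<le> y'" for y y'
  proof -
    have yS: "y / S \<le> y" "0 \<le> y / S" using S y mult_left_mono[of 1 S y] by (auto simp: divide_le_eq)
    consider "exp 1 \<le> y / S" | "y / S < exp 1" "y' < exp 1" | "y / S < exp 1" "exp 1 \<le> y'" by linarith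
    then show ?thesis
    proof cases
      case 1
      then have "exp 1 \<le> y'" and "0 < y / S" using yS y by (linarith, meson exp_gt_zero less_le_trans)
      then have "ln (y / S) \<le> ln y'" using yS y by (subst ln_le_cancel_iff) linarith+
      then show ?thesis
        unfolding M_fun_large[OF 1 dom] M_fun_large[OF \<open>exp 1 \<le> y'\<close> dom]
        by (intro SUP_mono) (auto intro!: ennreal_leI mult_left_mono)
    next
      case 2
      have "(y / S)\<^sup>2 \<le> y'\<^sup>2" using yS y by (intro power_mono) auto
      then show ?thesis using 2 yS y C by (simp add: M_fun_small ennreal_leI mult_left_mono)
    next
      case 3
      have y': "0 < y'" using 3 by (meson exp_gt_zero less_le_trans)
      have "M_fun C \<psi> (y / S) = ennreal (C * (y / S)\<^sup>2)" using 3 yS by (simp add: M_fun_small)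
      also have "\<dots> \<le> ennreal (y' / r)"
      proof (rule ennreal_leI)
        have "C * (y / S)\<^sup>2 \<le> C * (exp 1 * (y / S))"
          unfolding power2_eq_square using 3 yS C by (intro mult_left_mono mult_right_mono) auto
        also have "\<dots> \<le> C * (exp 1 * (y' / S))"
          using y S C by (intro mult_left_mono divide_right_mono) auto
        also have "\<dots> = (C * exp 1 * r / S) * (y' / r)" using r by simp
        also have "\<dots> \<le> 1 * (y' / r)"
          using S r y' by (intro mult_right_mono) (auto simp: divide_le_eq)
        finally show "C * (y / S)\<^sup>2 \<le> y' / r" by simp
      qed
      also have "y' / r = exp (1 * ln y' - v_fun \<psi> 1)"
        using exp_line_eq[OF y', of \<psi> 1] r y' by (simp add: r_def)
      also have "ennreal \<dots> \<le> M_fun C \<psi> y'"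
        unfolding M_fun_large[OF 3(2) dom] by (rule SUP_upper) (rule one)
      finally show ?thesis .
    qed
  qed
  then show thesis using S that by blast
qed

section \<open>From equality of the spaces to a norm inequality\<close>

lemma le_suminf_ennreal:
  fixes f :: "nat \<Rightarrow> ennreal"
  shows "f n \<le> (\<Sum>n. f n)"
  using sum_le_suminf[OF summableI, of "{n}" f] by simp

text \<open>Each \<open>z n\<close> is at most the \<open>p\<close>-th root of the sum, hence so is
  the supremum. Thus one pointwise supremum has its moments of all orders \<open>p\<close> bounded
  by sums.\<close>

lemma powr_SUP_le_suminf:
  fixes z :: "nat \<Rightarrow> real"
  assumes z: "\<And>n. 0 \<le> z n" and p: "1 \<le> p"
    and fin: "(SUP n. ennreal (z n)) < \<top>"
  shows "ennreal (enn2real (SUP n. ennreal (z n)) powr p) \<le> (\<Sum>n. ennreal (z n powr p))"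
proof (cases "\<Sum>n. ennreal (z n powr p)")
  case (real s)
  have "z n \<le> s powr (1 / p)" for n
  proof -
    have "ennreal (z n powr p) \<le> (\<Sum>n. ennreal (z n powr p))"
      by (rule le_suminf_ennreal)
    then have "z n powr p \<le> s" using real by simp
    then have "(z n powr p) powr (1 / p) \<le> s powr (1 / p)" using p by (intro powr_mono2) auto
    then show ?thesis using p z by (simp add: powr_powr)
  qed
  then have "(SUP n. ennreal (z n)) \<le> ennreal (s powr (1 / p))"
    by (intro SUP_least ennreal_leI)
  then have "enn2real (SUP n. ennreal (z n)) \<le> s powr (1 / p)"
    by (intro enn2real_leI) auto
  then have "enn2real (SUP n. ennreal (z n)) powr p \<le> (s powr (1 / p)) powr p"
    using p by (intro powr_mono2) auto
  then show ?thesis using real p by (simp add: powr_powr ennreal_leI)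
qed simp

text \<open>Gliding hump: countably many functions witnessing the failure of a uniform bound are
  dominated by a single function of the unit ball of the Grand Lebesgue Space.\<close>

lemma (in prob_space) GLS_ball_Orlicz_bounded:
  fixes \<psi> :: "real \<Rightarrow> ennreal"
  assumes \<psi>: "\<psi> \<in> Psi b" "1 < b" and C: "0 < C"
    and eq: "(GLS M b \<psi> :: ('a \<Rightarrow> 'k::{real_normed_field,euclidean_space}) set) = Orlicz_space M (M_fun C \<psi>)"
  shows "\<exists>D>0. \<forall>(g :: 'a \<Rightarrow> 'k) A. g \<in> borel_measurable M \<longrightarrow> 0 < A \<longrightarrow>
    GLS_norm M b \<psi> g \<le> ennreal A \<longrightarrow> Orlicz_norm M (M_fun C \<psi>) g \<le> ennreal (D * A)"
proof (rule ccontr)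
  assume neg: "\<not> ?thesis"
  \<comment> \<open>The weights satisfy \<open>(\<Sum>n. 1 / w n) = 1\<close>, so scaling the humps
    down by them keeps the sum in the unit ball. The \<open>n\<close>-th hump violates the bound
    with constant \<open>Suc n * w n\<close>, which still grows after this scaling.\<close>
  define w :: "nat \<Rightarrow> real" where "w n = 2 ^ Suc n" for n
  have w: "0 < w n" "1 \<le> w n" for n
    unfolding w_def by (simp, rule one_le_power, simp)
  have "\<exists>(g :: 'a \<Rightarrow> 'k) A. g \<in> borel_measurable M \<and> 0 < A \<and> GLS_norm M b \<psi> g \<le> ennreal A \<and>
      \<not> Orlicz_norm M (M_fun C \<psi>) g \<le> ennreal (real (Suc n) * w n * A)" for n
  proof -
    have "0 < real (Suc n) * w n" using w by simp
    then show ?thesis using neg by blast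
  qed
  then obtain g :: "nat \<Rightarrow> 'a \<Rightarrow> 'k" and A :: "nat \<Rightarrow> real"
    where [measurable]: "\<And>n. g n \<in> borel_measurable M" and A: "\<And>n. 0 < A n"
      and gA: "\<And>n. GLS_norm M b \<psi> (g n) \<le> ennreal (A n)"
      and big: "\<And>n. \<not> Orlicz_norm M (M_fun C \<psi>) (g n) \<le> ennreal (real (Suc n) * w n * A n)"
    by metis
  define z where "z n x = norm (g n x) / (A n * w n)" for n x
  have z: "0 \<le> z n x" for n x using A w by (simp add: z_def less_imp_le)
  have [measurable]: "z n \<in> borel_measurable M" for n unfolding z_def by measurable
  have sum_w: "(\<Sum>n. ennreal (1 / w n)) = 1"
  proof -
    have "(\<lambda>n. (1 / 2) ^ Suc n :: real) sums 1" using power_half_series by simp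
    then have "(\<Sum>n. ennreal (1 / w n)) = ennreal 1"
      by (intro suminf_ennreal_eq) (simp_all add: w_def power_one_over)
    then show ?thesis by simp
  qed
  have zp: "(\<integral>\<^sup>+x. (\<Sum>n. ennreal (z n x powr p)) \<partial>M) \<le> ennreal (enn2real (\<psi> p) powr p)"
    if p: "1 \<le> p" "ereal p < b" for p
  proof -
    define r where "r = enn2real (\<psi> p)"
    have r: "1 \<le> r" "ennreal r = \<psi> p" using Psi_enn2real_ge_1[OF \<psi> p] by (simp_all add: r_def)
    have "(\<integral>\<^sup>+x. ennreal (z n x powr p) \<partial>M) \<le> ennreal (r powr p) * ennreal (1 / w n)" for n
    proof -
      have "Lp_norm M p (g n) \<le> GLS_norm M b \<psi> (g n) * \<psi> p"
        by (rule Lp_norm_le_GLS_norm[OF \<psi> p])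
      also have "\<dots> \<le> ennreal (A n) * ennreal r" using gA r by (simp add: mult_right_mono)
      also have "\<dots> = ennreal (A n * r)" using A[of n] r by (simp add: ennreal_mult)
      finally have "(\<integral>\<^sup>+x. ennreal (norm (g n x) powr p) \<partial>M) \<le> ennreal ((A n * r) powr p)"
        using A[of n] r p by (simp add: Lp_norm_le_iff)
      then have "(\<integral>\<^sup>+x. ennreal (z n x powr p) \<partial>M)
          \<le> ennreal (1 / (A n * w n) powr p) * ennreal ((A n * r) powr p)"
        unfolding z_def using A[of n] w[of n] by (subst nn_integral_powr_scale) (auto intro!: mult_left_mono)
      also have "\<dots> = ennreal (r powr p / w n powr p)"
        using A[of n] w[of n] r by (simp add: powr_mult flip: ennreal_mult)
      also have "\<dots> \<le> ennreal (r powr p * (1 / w n))"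
      proof (rule ennreal_leI)
        \<comment> \<open>As \<open>p \<ge> 1\<close>, the factor \<open>1 / w n powr p\<close> is
          at most \<open>1 / w n\<close>, so the same weights work for every
          \<open>p\<close>.\<close>
        have "w n powr 1 \<le> w n powr p" using w p by (intro powr_mono) auto
        then have "r powr p / w n powr p \<le> r powr p / w n" using w[of n] by (intro divide_left_mono) auto
        then show "r powr p / w n powr p \<le> r powr p * (1 / w n)" by simp
      qed
      also have "\<dots> = ennreal (r powr p) * ennreal (1 / w n)" using w[of n] by (subst ennreal_mult) auto
      finally show ?thesis .
    qed
    then have "(\<Sum>n. \<integral>\<^sup>+x. ennreal (z n x powr p) \<partial>M) \<le> (\<Sum>n. ennreal (r powr p) * ennreal (1 / w n))"
      by (intro suminf_le summableI)
    then have "(\<integral>\<^sup>+x. (\<Sum>n. ennreal (z n x powr p)) \<partial>M) \<le> (\<Sum>n. ennreal (r powr p) * ennreal (1 / w n))"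
      by (subst nn_integral_suminf) measurable
    also have "\<dots> = ennreal (r powr p)" by (simp add: ennreal_suminf_cmult sum_w)
    finally show ?thesis by (simp add: r_def)
  qed
  define H where "H x = (SUP n. ennreal (z n x))" for x
  have [measurable]: "H \<in> borel_measurable M" unfolding H_def by measurable
  have b1: "ereal 1 < b" using \<psi> by (simp add: one_ereal_def)
  \<comment> \<open>The first moment alone makes the supremum finite almost everywhere.\<close>
  have "AE x in M. (\<Sum>n. ennreal (z n x powr 1)) \<noteq> \<infinity>"
  proof (rule nn_integral_noteq_infinite)
    show "(\<integral>\<^sup>+x. (\<Sum>n. ennreal (z n x powr 1)) \<partial>M) \<noteq> \<infinity>"
      using zp[OF order_refl b1] by (auto simp: top_unique)
  qed measurable
  then have Hfin: "AE x in M. H x < \<top>"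
  proof eventually_elim
    case (elim x)
    have "H x \<le> (\<Sum>n. ennreal (z n x))"
      unfolding H_def
    proof (rule SUP_least)
      show "ennreal (z n x) \<le> (\<Sum>n. ennreal (z n x))" for n
        by (rule le_suminf_ennreal)
    qed
    moreover have "(\<Sum>n. ennreal (z n x)) \<noteq> \<top>" using elim z by simp
    ultimately have "H x \<noteq> \<top>" by (auto simp: top_unique)
    then show ?case by (rule top.not_eq_extremum[THEN iffD1])
  qed
  \<comment> \<open>\<open>enn2real\<close> sends \<open>\<top>\<close> to 0, but only on a null
    set.\<close>
  define f :: "'a \<Rightarrow> 'k" where "f x = of_real (enn2real (H x))" for x
  have fm: "f \<in> borel_measurable M" unfolding f_def by measurable
  have "GLS_norm M b \<psi> f \<le> 1"
  proof (rule GLS_norm_le[OF \<psi>])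
    fix p assume p: "1 \<le> p" "ereal p < b"
    have "AE x in M. ennreal (norm (f x) powr p) \<le> (\<Sum>n. ennreal (z n x powr p))"
      using Hfin
    proof eventually_elim
      case (elim x)
      have "ennreal (enn2real (H x) powr p) \<le> (\<Sum>n. ennreal (z n x powr p))"
        unfolding H_def by (rule powr_SUP_le_suminf[OF z p(1) elim[unfolded H_def]])
      then show ?case by (simp add: f_def)
    qed
    then have "(\<integral>\<^sup>+x. ennreal (norm (f x) powr p) \<partial>M) \<le> (\<integral>\<^sup>+x. (\<Sum>n. ennreal (z n x powr p)) \<partial>M)"
      by (rule nn_integral_mono_AE)
    also note zp[OF p]
    finally have "Lp_norm M p f \<le> ennreal (enn2real (\<psi> p))" using p by (simp add: Lp_norm_le_iff)
    then show "Lp_norm M p f \<le> 1 * \<psi> p" using Psi_enn2real_ge_1[OF \<psi> p] by simp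
  qed
  \<comment> \<open>Here the equality of the spaces enters: it gives an admissible \<open>k\<close>
    for \<open>f\<close>, which dominates all humps simultaneously.\<close>
  then have "f \<in> Orlicz_space M (M_fun C \<psi>)"
    unfolding eq[symmetric] GLS_def using fm by (auto intro: order_le_less_trans)
  then obtain k where k: "0 < k" "(\<integral>\<^sup>+x. M_fun C \<psi> (norm (f x) / k) \<partial>M) \<le> 1"
    unfolding Orlicz_space_def using Orlicz_norm_finiteD by blast
  obtain S where S: "1 \<le> S"
    and shrink: "\<And>y y'. 0 \<le> y \<Longrightarrow> y \<le> y' \<Longrightarrow> M_fun C \<psi> (y / S) \<le> M_fun C \<psi> y'"
    using M_fun_shrink[OF \<psi> C] by blast
  \<comment> \<open>For such \<open>n\<close> the bound \<open>A n * w n * k * S\<close> inherited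
    from \<open>f\<close> contradicts the choice of \<open>g n\<close>.\<close>
  obtain n where n: "k * S \<le> real n" using real_arch_simple by blast
  have "AE x in M. M_fun C \<psi> (norm (g n x) / (A n * w n * k * S)) \<le> M_fun C \<psi> (norm (f x) / k)"
    using Hfin
  proof eventually_elim
    case (elim x)
    have "ennreal (z n x) \<le> H x" unfolding H_def by (rule SUP_upper) simp
    then have "ennreal (z n x) \<le> ennreal (enn2real (H x))" using elim by simp
    then have "z n x \<le> norm (f x)" by (simp add: f_def)
    then have "M_fun C \<psi> (z n x / k / S) \<le> M_fun C \<psi> (norm (f x) / k)"
      using z k by (intro shrink divide_right_mono divide_nonneg_pos) auto
    then show ?case by (simp add: z_def mult.assoc)
  qed
  then have "(\<integral>\<^sup>+x. M_fun C \<psi> (norm (g n x) / (A n * w n * k * S)) \<partial>M)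
      \<le> (\<integral>\<^sup>+x. M_fun C \<psi> (norm (f x) / k) \<partial>M)"
    by (rule nn_integral_mono_AE)
  also note k(2)
  finally have "Orlicz_norm M (M_fun C \<psi>) (g n) \<le> ennreal (A n * w n * k * S)"
    using A w k S by (intro Orlicz_norm_le) (auto intro!: mult_pos_pos)
  also have "\<dots> \<le> ennreal (real (Suc n) * w n * A n)"
  proof (rule ennreal_leI)
    have "(A n * w n) * (k * S) \<le> (A n * w n) * real (Suc n)"
      using n A[of n] w[of n] by (intro mult_left_mono) auto
    then show "A n * w n * k * S \<le> real (Suc n) * w n * A n" by (simp add: mult_ac)
  qed
  finally show False using big by blast
qed

section \<open>The operator estimate in the Orlicz norm and the theorem\<close>

lemma v_fun_bounded:
  assumes \<psi>: "\<psi> \<in> Psi b" "1 < b"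
  obtains B where "1 \<le> B" and "\<And>p. p \<in> dom_of \<psi> \<Longrightarrow> exp (- v_fun \<psi> p) \<le> B"
proof
  \<comment> \<open>Below \<open>b\<close> the function \<open>v_fun \<psi>\<close> is nonnegative,
    so only the single exponent \<open>p = b\<close> can need more than 1. For
    \<open>b = \<infinity>\<close> the default value 0 of \<open>real_of_ereal\<close> merely
    enlarges the maximum.\<close>
  define B where "B = max 1 (exp (- v_fun \<psi> (real_of_ereal b)))"
  show "1 \<le> B" by (simp add: B_def)
  show "exp (- v_fun \<psi> p) \<le> B" if p: "p \<in> dom_of \<psi>" for p
  proof (cases "ereal p < b")
    case True
    then have "0 \<le> v_fun \<psi> p"
      using Psi_enn2real_ge_1[OF \<psi>, of p] p by (simp add: v_fun_def)
    then show ?thesis by (simp add: B_def le_max_iff_disj)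
  next
    case False
    then have "b = ereal p" using Psi_dom_le[OF \<psi>, of p] p by auto
    then show ?thesis by (simp add: B_def)
  qed
qed

text \<open>If \<open>k\<close> is admissible for \<open>f\<close>, then \<open>D * Z * k\<close>
  times the \<open>q\<close>-th term of \<open>K_const\<close> is admissible for \<open>g\<close>:
  the ratio at \<open>q\<close> bounds the operator for all \<open>p \<ge> q\<close>, and
  \<open>\<psi> q\<close> normalises the \<open>q\<close>-th moment. Infima over \<open>q\<close>
  and then over \<open>k\<close> conclude.\<close>

lemma (in prob_space) Orlicz_norm_operator_le:
  fixes \<psi> :: "real \<Rightarrow> ennreal" and f g :: "'a \<Rightarrow> 'k::{real_normed_field,euclidean_space}"
  assumes [measurable]: "f \<in> borel_measurable M" "g \<in> borel_measurable M"
    and \<psi>: "\<psi> \<in> Psi b" "1 < b" and C: "0 < C"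
    and B: "1 \<le> B" "\<And>p. p \<in> dom_of \<psi> \<Longrightarrow> exp (- v_fun \<psi> p) \<le> B"
    and D: "exp 1 * (32 * exp 1 * B + 8) + 4 * C * exp 1 * exp 1 \<le> D"
    and l: "0 \<le> l" and Z: "0 < Z"
    and fin: "\<And>p. 1 < p \<Longrightarrow> ereal p < b \<Longrightarrow> Lp_norm M p f < \<top>"
    and le: "\<And>p. 1 < p \<Longrightarrow> ereal p < b \<Longrightarrow>
      Lp_norm M p g \<le> ennreal Z * ennreal (p powr l / (p - 1) powr l) * Lp_norm M p f"
  shows "Orlicz_norm M (M_fun C \<psi>) g
    \<le> ennreal D * K_const l \<psi> b * ennreal Z * Orlicz_norm M (M_fun C \<psi>) f"
proof -
  have D0: "0 < D"
  proof -
    have "0 < exp 1 * (32 * exp 1 * B + 8)" "0 < 4 * C * exp 1 * exp (1::real)"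
      using B C by (auto intro!: mult_pos_pos add_pos_pos)
    then show ?thesis using D by linarith
  qed
  have step: "Orlicz_norm M (M_fun C \<psi>) g
      \<le> ennreal (q powr l) * \<psi> q / ennreal ((q - 1) powr l) * ennreal (D * Z * k)"
    if q: "1 < q" "ereal q < b" and k: "0 < k" "(\<integral>\<^sup>+x. M_fun C \<psi> (norm (f x) / k) \<partial>M) \<le> 1" for q k
  proof -
    define r where "r = enn2real (\<psi> q)"
    have r: "1 \<le> r" "ennreal r = \<psi> q"
      using Psi_enn2real_ge_1[OF \<psi>, of q] q by (simp_all add: r_def)
    define c where "c = q powr l / (q - 1) powr l"
    have c: "0 < c" using q by (simp add: c_def)
    define A where "A = Z * c"
    have A: "0 < A" using Z c by (simp add: A_def)
    have leA: "Lp_norm M p g \<le> ennreal A * Lp_norm M p f" if p: "q \<le> p" "ereal p < b" for p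
    proof -
      have "Lp_norm M p g \<le> ennreal Z * ennreal (p powr l / (p - 1) powr l) * Lp_norm M p f"
        using le[of p] p q by simp
      also have "\<dots> \<le> ennreal Z * ennreal c * Lp_norm M p f"
        unfolding c_def using ratio_powr_antimono[of q p l] p q l
        by (intro mult_right_mono mult_left_mono ennreal_leI) auto
      also have "ennreal Z * ennreal c = ennreal A" using Z c by (simp add: A_def ennreal_mult)
      finally show ?thesis .
    qed
    have scaled: "(\<integral>\<^sup>+x. ennreal ((norm (g x) / (A * (r * k))) powr p) \<partial>M)
        \<le> (\<integral>\<^sup>+x. ennreal ((norm (f x) / (r * k)) powr p) \<partial>M)" if "q \<le> p" "ereal p < b" for p
      using that q r k A leA fin by (intro nn_integral_powr_scaled_le) auto
    have "(\<integral>\<^sup>+x. M_fun C \<psi> (norm (g x) / (A * (r * k)) / D) \<partial>M) \<le> 1"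
    proof (rule Orlicz_transfer[where F = "\<lambda>x. norm (f x) / k" and q = q, OF _ _ _ _ \<psi> q _ _ k(2) C B D])
      have "(\<integral>\<^sup>+x. ennreal ((norm (f x) / k / enn2real (\<psi> q)) powr q) \<partial>M) \<le> ennreal ((2 * exp 1) powr q)"
        using q k by (intro Orlicz_q_moment[OF _ _ \<psi>]) auto
      then show "(\<integral>\<^sup>+x. ennreal ((norm (g x) / (A * (r * k))) powr q) \<partial>M) \<le> ennreal ((2 * exp 1) powr q)"
        using scaled[OF order_refl q(2)] by (simp add: r_def mult.commute)
    next
      fix p assume p: "q \<le> p" "ereal p < b"
      \<comment> \<open>The division by \<open>r\<close> served the \<open>q\<close>-th moment
        through \<open>Orlicz_q_moment\<close>; in this comparison it is dropped because
        \<open>r \<ge> 1\<close>.\<close>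
      have "(\<integral>\<^sup>+x. ennreal ((norm (f x) / (r * k)) powr p) \<partial>M) \<le> (\<integral>\<^sup>+x. ennreal ((norm (f x) / k) powr p) \<partial>M)"
      proof (intro nn_integral_mono ennreal_leI powr_mono2)
        fix x
        have "norm (f x) / (r * k) \<le> norm (f x) / (1 * k)"
          using r k by (intro divide_left_mono mult_right_mono) auto
        then show "norm (f x) / (r * k) \<le> norm (f x) / k" by simp
      qed (use p q r k in auto)
      then show "(\<integral>\<^sup>+x. ennreal ((norm (g x) / (A * (r * k))) powr p) \<partial>M)
          \<le> (\<integral>\<^sup>+x. ennreal ((norm (f x) / k) powr p) \<partial>M)"
        using scaled[OF p] by (rule order_trans[rotated])
    qed (use A r k in auto)
    then have "Orlicz_norm M (M_fun C \<psi>) g \<le> ennreal (A * (r * k) * D)"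
      using A r k D0 by (intro Orlicz_norm_le) auto
    also have "\<dots> = ennreal (q powr l) * \<psi> q / ennreal ((q - 1) powr l) * ennreal (D * Z * k)"
      unfolding K_term_eq[OF q(1)] c_def[symmetric] r(2)[symmetric]
      using Z c r(1) k D0 by (simp add: A_def mult_ac flip: ennreal_mult)
    finally show ?thesis .
  qed
  show ?thesis
  proof (cases "Orlicz_norm M (M_fun C \<psi>) f = \<top>")
    case True
    \<comment> \<open>In \<open>ennreal\<close> the product \<open>0 * \<top>\<close> is 0, so an
      infinite right side requires \<open>K_const\<close> to be nonzero.\<close>
    have "1 \<le> K_const l \<psi> b"
      unfolding K_const_def
    proof (rule INF_greatest)
      fix q assume "q \<in> {q. 1 < q \<and> ereal q < b}"
      then have q: "1 < q" "ereal q < b" by auto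
      have "1 \<le> q powr l / (q - 1) powr l"
        using powr_mono2[of l "q - 1" q] q l by simp
      then have "1 * 1 \<le> ennreal (q powr l / (q - 1) powr l) * \<psi> q"
        using Psi_ge_1[OF \<psi>, of q] q by (intro mult_mono) auto
      then show "1 \<le> ennreal (q powr l) * \<psi> q / ennreal ((q - 1) powr l)"
        using q by (simp add: K_term_eq)
    qed
    then have "K_const l \<psi> b \<noteq> 0" by auto
    then show ?thesis using True D0 Z by (simp add: ennreal_mult_top)
  next
    case False
    have "Orlicz_norm M (M_fun C \<psi>) g
        \<le> (INF k\<in>{k. 0 < k \<and> (\<integral>\<^sup>+x. M_fun C \<psi> (norm (f x) / k) \<partial>M) \<le> 1}. ennreal k)
          * (K_const l \<psi> b * ennreal (D * Z))"
    proof (rule le_INF_mult_ennreal)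
      show "{k. 0 < k \<and> (\<integral>\<^sup>+x. M_fun C \<psi> (norm (f x) / k) \<partial>M) \<le> 1} \<noteq> {}"
        using False Orlicz_norm_finiteD[of M "M_fun C \<psi>" f] by (auto simp: less_top[symmetric])
      show "K_const l \<psi> b * ennreal (D * Z) < \<top>"
        using K_const_finite[OF \<psi>, of l] by (simp add: ennreal_mult_less_top)
      fix k assume "k \<in> {k. 0 < k \<and> (\<integral>\<^sup>+x. M_fun C \<psi> (norm (f x) / k) \<partial>M) \<le> 1}"
      then have k: "0 < k" "(\<integral>\<^sup>+x. M_fun C \<psi> (norm (f x) / k) \<partial>M) \<le> 1" by auto
      have "Orlicz_norm M (M_fun C \<psi>) g \<le> K_const l \<psi> b * ennreal (D * Z * k)"
        unfolding K_const_def using step k open_interval_nonempty[OF \<psi>(2)]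
        by (intro le_INF_mult_ennreal) auto
      also have "\<dots> = ennreal k * (K_const l \<psi> b * ennreal (D * Z))"
        using D0 Z k by (simp add: ennreal_mult mult_ac)
      finally show "Orlicz_norm M (M_fun C \<psi>) g \<le> ennreal k * (K_const l \<psi> b * ennreal (D * Z))" .
    qed
    also have "\<dots> = ennreal D * K_const l \<psi> b * ennreal Z * Orlicz_norm M (M_fun C \<psi>) f"
      unfolding Orlicz_norm_def using D0 Z by (simp add: ennreal_mult mult_ac)
    finally show ?thesis .
  qed
qed

theorem theorem3p1:
  fixes M :: "'a measure" and b :: ereal and \<psi> :: "real \<Rightarrow> ennreal" and C :: real
  assumes "prob_space M" and "1 < b" and "\<psi> \<in> Psi b" and "0 < C"
  shows "\<exists>D::real. 0 < D \<and> (\<forall>l::real. 0 < l \<longrightarrow>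
    (\<forall>(Q :: ('a \<Rightarrow> 'k::{real_normed_field,euclidean_space}) \<Rightarrow> ('a \<Rightarrow> 'k)) (Z::real) f.
       (\<forall>p>1. \<forall>h\<in>Lp_space M p. Q h \<in> Lp_space M p) \<and>
       0 \<le> Z \<and>
       (\<forall>p. 1 \<le> p \<and> ereal p < b \<longrightarrow> (\<forall>h\<in>Lp_space M p.
          Lp_norm M p (Q h) \<le>
            (if p = 1 then \<top>
             else ennreal Z * ennreal (p powr l / (p - 1) powr l) * Lp_norm M p h))) \<and>
       f \<in> GLS M b \<psi> \<longrightarrow>
         Q f \<in> GLS M b \<psi> \<and>
         GLS_norm M b \<psi> (Q f) \<le> K_const l \<psi> b * ennreal Z * GLS_norm M b \<psi> f \<and>
         (f \<in> Orlicz_space M (M_fun C \<psi>) \<longrightarrow> Q f \<in> Orlicz_space M (M_fun C \<psi>)) \<and>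
         ((GLS M b \<psi> :: ('a \<Rightarrow> 'k) set) = Orlicz_space M (M_fun C \<psi>) \<longrightarrow>
            Q f \<in> Orlicz_space M (M_fun C \<psi>)) \<and>
         Orlicz_norm M (M_fun C \<psi>) (Q f) \<le>
           ennreal D * K_const l \<psi> b * ennreal Z * Orlicz_norm M (M_fun C \<psi>) f) \<and>
    (\<forall>(N::enat) (Q :: (nat \<Rightarrow> 'a \<Rightarrow> 'k) \<Rightarrow> ('a \<Rightarrow> 'k)) (F :: nat \<Rightarrow> 'a \<Rightarrow> 'k) (Z::real) g.
       1 \<le> N \<and>
       F \<in> {i. enat i < N} \<rightarrow>\<^sub>E borel_measurable M \<and>
       g = Q F \<and> g \<in> borel_measurable M \<and>
       0 \<le> Z \<and>
       (\<forall>p. 1 \<le> p \<and> ereal p < b \<longrightarrow>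
          Lp_norm M p g \<le>
            (if p = 1 then \<top>
             else ennreal Z * ennreal (p powr l / (p - 1) powr l) * \<psi> p)) \<longrightarrow>
         g \<in> GLS M b \<psi> \<and>
         GLS_norm M b \<psi> g \<le> K_const l \<psi> b * ennreal Z \<and>
         ((GLS M b \<psi> :: ('a \<Rightarrow> 'k) set) = Orlicz_space M (M_fun C \<psi>) \<longrightarrow>
            g \<in> Orlicz_space M (M_fun C \<psi>) \<and>
            Orlicz_norm M (M_fun C \<psi>) g \<le> ennreal D * K_const l \<psi> b * ennreal Z)))"
proof -
  interpret prob_space M by fact
  note \<psi> = assms(3,2)
  obtain B where B: "1 \<le> B" "\<And>p. p \<in> dom_of \<psi> \<Longrightarrow> exp (- v_fun \<psi> p) \<le> B"
    using v_fun_bounded[OF \<psi>] by blast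
  \<comment> \<open>\<open>D1\<close> serves the operator estimate and \<open>D2\<close> the general
    family; their sum is fixed before \<open>l\<close>, \<open>Q\<close> and
    \<open>Z\<close>.\<close>
  define D1 where "D1 = exp 1 * (32 * exp 1 * B + 8) + 4 * C * exp 1 * exp (1::real)"
  have D1: "0 < D1" using B assms(4) by (auto simp: D1_def intro!: add_pos_pos mult_pos_pos)
  \<comment> \<open>If the two spaces differ, the implication is vacuous and any positive
    \<open>D2\<close> will do.\<close>
  obtain D2 where D2: "0 < D2"
    and ball: "(GLS M b \<psi> :: ('a \<Rightarrow> 'k) set) = Orlicz_space M (M_fun C \<psi>) \<Longrightarrow>
      \<forall>(g :: 'a \<Rightarrow> 'k) A. g \<in> borel_measurable M \<longrightarrow> 0 < A \<longrightarrow>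
        GLS_norm M b \<psi> g \<le> ennreal A \<longrightarrow> Orlicz_norm M (M_fun C \<psi>) g \<le> ennreal (D2 * A)"
    using GLS_ball_Orlicz_bounded[OF \<psi> assms(4), where 'k = 'k] by (metis zero_less_one)
  obtain q0 where q0: "1 < q0" "ereal q0 < b" using open_interval_nonempty[OF \<psi>(2)] by auto
  have KZ: "K_const l \<psi> b * ennreal Z < \<top>" for l Z
    using K_const_finite[OF \<psi>, of l] by (simp add: ennreal_mult_less_top)
  show ?thesis
  proof (intro exI[of _ "D1 + D2"] conjI allI impI; (elim conjE)?)
    show "0 < D1 + D2" using D1 D2 by simp
  next
    fix l :: real and Q :: "('a \<Rightarrow> 'k) \<Rightarrow> 'a \<Rightarrow> 'k" and Z :: real and f :: "'a \<Rightarrow> 'k"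
    assume l: "0 < l" and Q: "\<forall>p>1. \<forall>h\<in>Lp_space M p. Q h \<in> Lp_space M p" and Z: "0 \<le> Z"
      and le: "\<forall>p. 1 \<le> p \<and> ereal p < b \<longrightarrow> (\<forall>h\<in>Lp_space M p.
          Lp_norm M p (Q h) \<le>
            (if p = 1 then \<top>
             else ennreal Z * ennreal (p powr l / (p - 1) powr l) * Lp_norm M p h))"
      and f: "f \<in> GLS M b \<psi>"
    have fm: "f \<in> borel_measurable M" and ffin: "GLS_norm M b \<psi> f < \<top>" using f by (auto simp: GLS_def)
    have Lpf: "Lp_norm M p f < \<top>" if "1 < p" "ereal p < b" for p
    proof -
      have "Lp_norm M p f \<le> GLS_norm M b \<psi> f * \<psi> p" using that by (intro Lp_norm_le_GLS_norm[OF \<psi>]) auto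
      also have "\<dots> < \<top>" using ffin Psi_finite[OF \<psi>, of p] that by (simp add: ennreal_mult_less_top)
      finally show ?thesis .
    qed
    have fLp: "f \<in> Lp_space M p" if "1 < p" "ereal p < b" for p
      using Lpf[OF that] fm by (simp add: Lp_space_def)
    \<comment> \<open>Measurability of \<open>Q f\<close> comes from the mapping property of
      \<open>Q\<close> at one exponent \<open>q0\<close> between 1 and \<open>b\<close>.\<close>
    have gm: "Q f \<in> borel_measurable M" using Q q0 fLp[OF q0] by (auto simp: Lp_space_def)
    have leg: "Lp_norm M p (Q f) \<le> ennreal Z * ennreal (p powr l / (p - 1) powr l) * Lp_norm M p f"
      if "1 < p" "ereal p < b" for p
      using le[rule_format, of p f] fLp[OF that] that by simp
    have "GLS_norm M b \<psi> (Q f) \<le> K_const l \<psi> b * (ennreal Z * GLS_norm M b \<psi> f)"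
    proof (rule GLS_norm_le_K_const[OF \<psi> less_imp_le[OF l] _ gm])
      show "ennreal Z * GLS_norm M b \<psi> f < \<top>" using ffin by (simp add: ennreal_mult_less_top)
      fix p assume p: "1 < p" "ereal p < b"
      note leg[OF p]
      also have "ennreal Z * ennreal (p powr l / (p - 1) powr l) * Lp_norm M p f
          \<le> ennreal Z * ennreal (p powr l / (p - 1) powr l) * (GLS_norm M b \<psi> f * \<psi> p)"
        using p by (intro mult_left_mono Lp_norm_le_GLS_norm[OF \<psi>]) auto
      finally show "Lp_norm M p (Q f)
          \<le> ennreal (p powr l / (p - 1) powr l) * (ennreal Z * GLS_norm M b \<psi> f) * \<psi> p"
        by (simp add: mult_ac)
    qed
    then show G: "GLS_norm M b \<psi> (Q f) \<le> K_const l \<psi> b * ennreal Z * GLS_norm M b \<psi> f"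
      by (simp add: mult.assoc)
    also have "\<dots> < \<top>" using KZ ffin by (simp add: ennreal_mult_less_top)
    finally show "Q f \<in> GLS M b \<psi>" using gm by (simp add: GLS_def)
    show O: "Orlicz_norm M (M_fun C \<psi>) (Q f)
        \<le> ennreal (D1 + D2) * K_const l \<psi> b * ennreal Z * Orlicz_norm M (M_fun C \<psi>) f"
    proof (cases "Z = 0")
      case True
      then have "AE x in M. Q f x = 0"
        using leg[OF q0] q0 by (intro Lp_norm_eq_0_AE[OF gm, of q0]) auto
      then show ?thesis by (simp add: Orlicz_norm_AE_zero)
    next
      case False
      then show ?thesis
        using Z l D2 by (intro Orlicz_norm_operator_le[OF fm gm \<psi> assms(4) B] Lpf leg) (auto simp: D1_def)
    qed
    show "Q f \<in> Orlicz_space M (M_fun C \<psi>)" if "f \<in> Orlicz_space M (M_fun C \<psi>)"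
    proof -
      note O
      also have "ennreal (D1 + D2) * K_const l \<psi> b * ennreal Z * Orlicz_norm M (M_fun C \<psi>) f < \<top>"
        using that K_const_finite[OF \<psi>, of l] by (simp add: Orlicz_space_def ennreal_mult_less_top)
      finally show ?thesis using gm by (simp add: Orlicz_space_def)
    qed
    then show "Q f \<in> Orlicz_space M (M_fun C \<psi>)"
      if "(GLS M b \<psi> :: ('a \<Rightarrow> 'k) set) = Orlicz_space M (M_fun C \<psi>)"
      using f that by simp
  next
    fix l :: real and N :: enat and Q :: "(nat \<Rightarrow> 'a \<Rightarrow> 'k) \<Rightarrow> 'a \<Rightarrow> 'k" and F Z and g :: "'a \<Rightarrow> 'k"
    assume l: "0 < l" and gm: "g \<in> borel_measurable M" and Z: "0 \<le> Z"
      and le: "\<forall>p. 1 \<le> p \<and> ereal p < b \<longrightarrow>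
          Lp_norm M p g \<le>
            (if p = 1 then \<top>
             else ennreal Z * ennreal (p powr l / (p - 1) powr l) * \<psi> p)"
    show G: "GLS_norm M b \<psi> g \<le> K_const l \<psi> b * ennreal Z"
    proof (rule GLS_norm_le_K_const[OF \<psi> less_imp_le[OF l] _ gm])
      show "Lp_norm M p g \<le> ennreal (p powr l / (p - 1) powr l) * ennreal Z * \<psi> p"
        if "1 < p" "ereal p < b" for p
        using le[rule_format, of p] that by (simp add: mult_ac)
    qed simp
    then show gG: "g \<in> GLS M b \<psi>" using gm KZ[of l Z] by (simp add: GLS_def order_le_less_trans)
    assume eq: "(GLS M b \<psi> :: ('a \<Rightarrow> 'k) set) = Orlicz_space M (M_fun C \<psi>)"
    show "g \<in> Orlicz_space M (M_fun C \<psi>)" using gG eq by simp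
    obtain k where k: "0 \<le> k" "K_const l \<psi> b * ennreal Z = ennreal k"
      using KZ[of l Z] by (cases "K_const l \<psi> b * ennreal Z") auto
    \<comment> \<open>\<open>ball\<close> asks for a positive radius, while \<open>k\<close> may be
      0; hence the radius \<open>k + e / D2\<close> and the passage to small
      \<open>e\<close>.\<close>
    have "Orlicz_norm M (M_fun C \<psi>) g \<le> ennreal (D2 * k) + ennreal e" if e: "0 < e" for e
    proof -
      have "GLS_norm M b \<psi> g \<le> ennreal (k + e / D2)"
        using G k D2 e by (auto intro!: order_trans[OF G] ennreal_leI)
      then have "Orlicz_norm M (M_fun C \<psi>) g \<le> ennreal (D2 * (k + e / D2))"
        using ball[OF eq] gm k D2 e by (simp add: add_nonneg_pos)
      also have "\<dots> = ennreal (D2 * k) + ennreal e"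
        using D2 k e by (simp add: distrib_left)
      finally show ?thesis .
    qed
    then have "Orlicz_norm M (M_fun C \<psi>) g \<le> ennreal (D2 * k)" by (rule ennreal_le_epsilon)
    also have "\<dots> \<le> ennreal ((D1 + D2) * k)" using D1 k by (intro ennreal_leI mult_right_mono) auto
    also have "\<dots> = ennreal (D1 + D2) * K_const l \<psi> b * ennreal Z"
      using D1 D2 k by (simp add: mult.assoc ennreal_mult)
    finally show "Orlicz_norm M (M_fun C \<psi>) g \<le> ennreal (D1 + D2) * K_const l \<psi> b * ennreal Z" .
  qed
qed

end
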